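(* Let $K>0$ be a real number and let $a=a_N>0$ be real numbers with $a\to 0$ as $N\to\infty$; put $\alpha=a/N$. Then, as $N\to\infty$, $$\left(\frac{-a}{N}\right)^K\int_{SO(2N+1)}\left(\frac{\Lambda_X'}{\Lambda_X}(e^{-\alpha})\right)^K\,\mathrm{d}_{\mathrm{Haar}}(X)=1-Ka+\mathcal{O}(a/N)+\mathcal{O}(a^2).$$
   Context: $SO(2N+1)$ is the group of real $(2N+1)\times(2N+1)$ matrices $X$ with $XX^T=X^TX=I$ and $\det X=1$, and $\mathrm{d}_{\mathrm{Haar}}(X)$ is its Haar probability measure. The characteristic polynomial is $\Lambda_X(s)=\det(I-sX^* )$, where $X^*$ is the conjugate transpose, and $\Lambda_X'/\Lambda_X$ is its logarithmic derivative in $s$. For non-integer $K$ the powers are read with the same branch of $(-1)^K$ for both factors, i.e. the left-hand side means $\int_{SO(2N+1)}\left(\frac{-a}{N}\cdot\frac{\Lambda_X'}{\Lambda_X}(e^{-\alpha})\right)^K\mathrm{d}_{\mathrm{Haar}}(X)$; for $N$ large the base of this power is a positive real number. Implied constants may depend on $K$ but not on $N$. *)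

theory Defs
  imports "HOL-Probability.Probability_Measure" "Jordan_Normal_Form.Schur_Decomposition"
begin

text \<open>Jordan-Normal-Form matrices carry their dimension as a term, so that it can tend to infinity.
  Both HOL-Analysis and Jordan-Normal-Form have a constant called det; the latter is meant
  throughout.\<close>

hide_const (open) Determinants.det

definition SO :: "nat \<Rightarrow> real mat set" where
  "SO n = {X \<in> carrier_mat n n.
     X * transpose_mat X = 1\<^sub>m n \<and> transpose_mat X * X = 1\<^sub>m n \<and> Determinant.det X = 1}"

text \<open>The type of matrices has no topology in the library. The Borel sets of \<open>SO n\<close> are those of
  the subspace topology inherited from the n*n entries, that is, the pullback of the (finite)
  product Borel algebra along the map sending a matrix to its entries.\<close>

definition borel_SO :: "nat \<Rightarrow> real mat measure" where
  "borel_SO n = vimage_algebra (SO n)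
     (\<lambda>X. \<lambda>ij\<in>{..<n} \<times> {..<n}. X $$ ij)
     (PiM ({..<n} \<times> {..<n}) (\<lambda>_. borel))"

text \<open>The measure in \<open>borel_SO n\<close> is irrelevant; only its sets matter. The group is compact, so
  a left-invariant Borel probability measure is unique and also right-invariant.\<close>

definition haar_prob_SO :: "nat \<Rightarrow> real mat measure \<Rightarrow> bool" where
  "haar_prob_SO n \<mu> \<longleftrightarrow>
     prob_space \<mu> \<and> space \<mu> = SO n \<and> sets \<mu> = sets (borel_SO n) \<and>
     (\<forall>G\<in>SO n. distr \<mu> \<mu> (\<lambda>X. G * X) = \<mu>)"

text \<open>\<open>mat_adjoint\<close> is the conjugate transpose (over the reals: the transpose).\<close>

definition char_fun :: "'a::conjugatable_field mat \<Rightarrow> 'a \<Rightarrow> 'a" where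
  "char_fun X s = Determinant.det (1\<^sub>m (dim_row X) - s \<cdot>\<^sub>m mat_adjoint X)"

definition log_deriv :: "('a::real_normed_field \<Rightarrow> 'a) \<Rightarrow> 'a \<Rightarrow> 'a" where
  "log_deriv f s = deriv f s / f s"

end

theory Submission
  imports Defs
begin

text \<open>Put \<open>n = 2N + 1\<close>, \<open>s = exp (-\<alpha>)\<close> and \<open>B = (1 - s X)\<^sup>-\<^sup>1\<close>. By Jacobi's formula the base of the power is
  \<open>\<alpha> (tr B - n) / s = \<alpha> / (1 - s) - a / s + (\<alpha> / s) \<tau>\<close>, where the eigenvalue \<open>1\<close> of \<open>X\<close> accounts for the
  first term and \<open>\<tau> \<ge> 0\<close> is a Poisson-kernel sum over the other eigenvalues. The first two terms
  give \<open>1 - a + O(\<alpha>)\<close>, so everything reduces to bounding the moments of \<open>\<alpha> \<tau>\<close> by \<open>O(a\<^sup>2)\<close>.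

  Weyl's integration formula is avoided. The Haar integral of \<open>(B\<^sub>j\<^sub>i - B\<^sub>i\<^sub>j) \<tau>\<^sup>p\<close> does not change under
  a rotation of the \<open>(i,j)\<close> plane; differentiating at the identity and summing over \<open>i\<close> and \<open>j\<close> gives
  \<open>E (\<tau>\<^sup>p\<^sup>+\<^sup>2) + 2 s / (1 - s\<^sup>2) E (\<tau>\<^sup>p\<^sup>+\<^sup>1) = N\<^sup>2 E (\<tau>\<^sup>p) + p E (\<tau>\<^sup>p\<^sup>-\<^sup>1 W) / 2\<close>,
  where \<open>W\<close> is \<open>1 - s\<^sup>2\<close> times the squared Frobenius norm of \<open>(B - B\<^sup>T) B\<close> and \<open>W \<le> 8 \<tau> / (1 - s)\<^sup>2\<close>.
  Hence \<open>E ((1 - s) \<tau>)\<^sup>m = O(((1 - s) N)\<^sup>2) = O(a\<^sup>2)\<close> for every \<open>m \<ge> 1\<close> by induction on \<open>m\<close>.\<close>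

subsection \<open>The Frobenius product and the resolvent of an orthogonal matrix\<close>

definition frob :: "nat \<Rightarrow> real mat \<Rightarrow> real mat \<Rightarrow> real" where
  "frob n A B = (\<Sum>i<n. \<Sum>j<n. A $$ (i,j) * B $$ (i,j))"

lemma frob_sym: "frob n A B = frob n B A"
  by (simp add: frob_def mult.commute)

lemma frob_nonneg: "frob n A A \<ge> 0"
  by (auto simp: frob_def intro!: sum_nonneg)

lemma frob_add: "A \<in> carrier_mat n n \<Longrightarrow> B \<in> carrier_mat n n \<Longrightarrow> frob n (A + B) C = frob n A C + frob n B C"
  by (simp add: frob_def sum.distrib distrib_right)

lemma frob_diff: "A \<in> carrier_mat n n \<Longrightarrow> B \<in> carrier_mat n n \<Longrightarrow> frob n (A - B) C = frob n A C - frob n B C"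
  by (simp add: frob_def sum_subtractf left_diff_distrib)

lemma frob_smult: "A \<in> carrier_mat n n \<Longrightarrow> frob n (c \<cdot>\<^sub>m A) B = c * frob n A B"
  by (simp add: frob_def sum_distrib_left mult.assoc)

lemma index_mult: "A \<in> carrier_mat n n \<Longrightarrow> B \<in> carrier_mat n n \<Longrightarrow> i < n \<Longrightarrow> j < n \<Longrightarrow>
   (A * B) $$ (i,j) = (\<Sum>k<n. A $$ (i,k) * B $$ (k,j))"
  by (auto simp: scalar_prod_def lessThan_atLeast0 intro!: sum.cong)

lemma frob_mult_left:
  assumes "A \<in> carrier_mat n n" "B \<in> carrier_mat n n" "C \<in> carrier_mat n n"
  shows "frob n (A * B) C = frob n B (transpose_mat A * C)"
proof -
  have "frob n (A * B) C = (\<Sum>i<n. \<Sum>j<n. \<Sum>k<n. A $$ (i,k) * B $$ (k,j) * C $$ (i,j))"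
    unfolding frob_def using assms by (simp add: index_mult sum_distrib_right del: index_mult_mat)
  also have "\<dots> = (\<Sum>k<n. \<Sum>j<n. \<Sum>i<n. A $$ (i,k) * B $$ (k,j) * C $$ (i,j))"
    by (subst sum.swap, subst (2) sum.swap, subst sum.swap) simp
  also have "\<dots> = frob n B (transpose_mat A * C)"
    unfolding frob_def using assms 
    by (simp add: index_mult sum_distrib_left sum_distrib_right del: index_mult_mat)
       (simp add: ac_simps)
  finally show ?thesis .
qed

lemma frob_transpose: "A \<in> carrier_mat n n \<Longrightarrow> B \<in> carrier_mat n n \<Longrightarrow>
   frob n (transpose_mat A) (transpose_mat B) = frob n A B"
  by (subst frob_def, subst sum.swap) (simp add: frob_def)

lemma frob_mult_right:
  assumes "A \<in> carrier_mat n n" "B \<in> carrier_mat n n" "C \<in> carrier_mat n n"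
  shows "frob n (A * B) C = frob n A (C * transpose_mat B)"
proof -
  have "frob n (A * B) C = frob n (transpose_mat B * transpose_mat A) (transpose_mat C)"
    using assms frob_transpose[of "A*B" n C] by (simp add: transpose_mult)
  also have "\<dots> = frob n (transpose_mat A) (transpose_mat (C * transpose_mat B))"
    using assms by (subst frob_mult_left[of _ n]) (auto simp: transpose_mult)
  finally show ?thesis using assms by (subst (asm) frob_transpose) auto
qed

lemma frob_diff_right: "A \<in> carrier_mat n n \<Longrightarrow> B \<in> carrier_mat n n \<Longrightarrow> frob n C (A - B) = frob n C A - frob n C B"
  by (metis frob_diff frob_sym)

lemma frob_add_right: "A \<in> carrier_mat n n \<Longrightarrow> B \<in> carrier_mat n n \<Longrightarrow> frob n C (A + B) = frob n C A + frob n C B"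
  by (metis frob_add frob_sym)

lemma frob_smult_right: "B \<in> carrier_mat n n \<Longrightarrow> frob n A (c \<cdot>\<^sub>m B) = c * frob n A B"
  by (metis frob_smult frob_sym)

lemma frob_one: "frob n A (1\<^sub>m n) = (\<Sum>i<n. A $$ (i,i))"
  by (simp add: frob_def if_distrib cong: if_cong)

lemma frob_one_one: "frob n (1\<^sub>m n) (1\<^sub>m n) = real n"
  by (simp add: frob_one)

lemma frob_isometry:
  assumes "X \<in> carrier_mat n n" "transpose_mat X * X = 1\<^sub>m n" "A \<in> carrier_mat n n" "B \<in> carrier_mat n n"
  shows "frob n (X * A) (X * B) = frob n A B"
  using assms by (simp add: frob_mult_left assoc_mult_mat[symmetric, where n\<^sub>2=n and n\<^sub>3=n and n\<^sub>4=n])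

text \<open>Multiplication by \<open>X\<close> preserves the Frobenius norm, so expanding the
  nonnegative norm of \<open>U - X * U\<close> bounds the cross term \<open>frob n U (X * U)\<close>
  by \<open>frob n U U\<close>. Hence \<open>1 - s X\<close> shrinks lengths by at most the factor
  \<open>1 - s\<close>, which yields both its invertibility and a norm bound for its
  inverse.\<close>

lemma frob_contraction:
  assumes X: "X \<in> carrier_mat n n" "transpose_mat X * X = 1\<^sub>m n" and U: "U \<in> carrier_mat n n"
    and s: "0 \<le> s"
  shows "(1 - s)\<^sup>2 * frob n U U \<le> frob n (U - s \<cdot>\<^sub>m (X * U)) (U - s \<cdot>\<^sub>m (X * U))"
proof -
  have XU: "X * U \<in> carrier_mat n n" using X U by simp
  have "0 \<le> frob n (U - X * U) (U - X * U)" by (rule frob_nonneg)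
  also have "\<dots> = 2 * frob n U U - 2 * frob n U (X * U)"
    using U XU by (simp add: frob_diff frob_diff_right frob_isometry[OF X U U] frob_sym[of n "X * U" U])
  finally have le: "frob n U (X * U) \<le> frob n U U" by simp
  have "frob n (U - s \<cdot>\<^sub>m (X * U)) (U - s \<cdot>\<^sub>m (X * U)) = (1 + s\<^sup>2) * frob n U U - 2 * s * frob n U (X * U)"
    using U XU by (simp add: frob_diff frob_diff_right frob_smult frob_smult_right frob_isometry[OF X U U]
      frob_sym[of n "X * U" U] power2_eq_square algebra_simps)
  also have "\<dots> \<ge> (1 + s\<^sup>2) * frob n U U - 2 * s * frob n U U"
    using mult_left_mono[OF le, of "2 * s"] s by simp
  finally show ?thesis by (simp add: power2_eq_square algebra_simps)
qed

lemma det_one_minus_smult_ne_0: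
  fixes X :: "real mat"
  assumes X: "X \<in> carrier_mat n n" "transpose_mat X * X = 1\<^sub>m n" and s: "0 \<le> s" "s < 1"
  shows "Determinant.det (1\<^sub>m n - s \<cdot>\<^sub>m X) \<noteq> 0"
proof
  assume "Determinant.det (1\<^sub>m n - s \<cdot>\<^sub>m X) = 0"
  moreover have M: "1\<^sub>m n - s \<cdot>\<^sub>m X \<in> carrier_mat n n" using X by (simp add: minus_carrier_mat)
  ultimately obtain v where v: "v \<in> carrier_vec n" "v \<noteq> 0\<^sub>v n" "(1\<^sub>m n - s \<cdot>\<^sub>m X) *\<^sub>v v = 0\<^sub>v n"
    by (auto simp: det_0_iff_vec_prod_zero_field[OF M])
  \<comment> \<open>Every column of \<open>U\<close> is the null vector \<open>v\<close>, so that
    the estimate for square matrices applies to a single vector.\<close>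
  define U where "U = mat n n (\<lambda>(i, j). vec_index v i)"
  have U: "U \<in> carrier_mat n n" by (simp add: U_def)
  have 0: "(1\<^sub>m n - s \<cdot>\<^sub>m X) * U = 0\<^sub>m n n"
  proof (rule eq_matI)
    fix i j assume ij: "i < dim_row (0\<^sub>m n n)" "j < dim_col (0\<^sub>m n n)"
    have "((1\<^sub>m n - s \<cdot>\<^sub>m X) * U) $$ (i, j) = vec_index ((1\<^sub>m n - s \<cdot>\<^sub>m X) *\<^sub>v v) i"
      using ij X(1) v(1) U by (auto simp: U_def scalar_prod_def intro!: sum.cong)
    then show "((1\<^sub>m n - s \<cdot>\<^sub>m X) * U) $$ (i, j) = 0\<^sub>m n n $$ (i, j)" using ij v by simp
  qed (use X U in auto)
  have "(1\<^sub>m n - s \<cdot>\<^sub>m X) * U = U - s \<cdot>\<^sub>m (X * U)"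
    using X U by (simp add: minus_mult_distrib_mat[where nr=n and n=n and nc=n] mult_smult_assoc_mat[where nr=n and n=n and nc=n])
  then have "(1 - s)\<^sup>2 * frob n U U \<le> frob n (0\<^sub>m n n) (0\<^sub>m n n)"
    using frob_contraction[OF X U s(1)] 0 by simp
  also have "\<dots> = 0" by (simp add: frob_def)
  finally have "frob n U U \<le> 0" using s by (simp add: mult_le_0_iff)
  moreover have "frob n U U = (\<Sum>i<n. real n * (vec_index v i)\<^sup>2)"
    by (simp add: frob_def U_def power2_eq_square)
  ultimately have "(\<Sum>i<n. real n * (vec_index v i)\<^sup>2) = 0"
    by (simp add: order_antisym sum_nonneg)
  then have "\<forall>i<n. vec_index v i = 0" by (subst (asm) sum_nonneg_eq_0_iff) auto
  then have "v = 0\<^sub>v n" using v(1) by (intro eq_vecI) auto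
  with v show False by simp
qed

text \<open>Cramer's formula for the inverse of \<open>1 - s X\<close>. It exhibits the entries as
  rational functions of the entries of \<open>X\<close>, from which measurability follows.\<close>

definition resolvent :: "nat \<Rightarrow> real \<Rightarrow> real mat \<Rightarrow> real mat" where
  "resolvent n s X = (1 / Determinant.det (1\<^sub>m n - s \<cdot>\<^sub>m X)) \<cdot>\<^sub>m adj_mat (1\<^sub>m n - s \<cdot>\<^sub>m X)"

lemma resolvent:
  assumes X: "X \<in> carrier_mat n n" "transpose_mat X * X = 1\<^sub>m n" and s: "0 \<le> s" "s < 1"
  shows resolvent_carrier: "resolvent n s X \<in> carrier_mat n n"
    and resolvent_right: "(1\<^sub>m n - s \<cdot>\<^sub>m X) * resolvent n s X = 1\<^sub>m n"
    and resolvent_eq1: "resolvent n s X - s \<cdot>\<^sub>m (X * resolvent n s X) = 1\<^sub>m n"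
    and resolvent_eq2: "resolvent n s X - s \<cdot>\<^sub>m (resolvent n s X * X) = 1\<^sub>m n"
proof -
  let ?M = "1\<^sub>m n - s \<cdot>\<^sub>m X"
  have M: "?M \<in> carrier_mat n n" using X by (simp add: minus_carrier_mat)
  note a = adj_mat[OF M]
  have d: "Determinant.det ?M \<noteq> 0" by (rule det_one_minus_smult_ne_0[OF X s])
  show c: "resolvent n s X \<in> carrier_mat n n" using a by (simp add: resolvent_def)
  have sm: "(1 / Determinant.det ?M) \<cdot>\<^sub>m (Determinant.det ?M \<cdot>\<^sub>m 1\<^sub>m n) = (1\<^sub>m n :: real mat)"
    using d by (intro eq_matI) auto
  show r: "?M * resolvent n s X = 1\<^sub>m n"
    using M a sm by (simp add: resolvent_def mult_smult_distrib[OF M a(1)])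
  have l: "resolvent n s X * ?M = 1\<^sub>m n"
    using M a sm by (simp add: resolvent_def mult_smult_assoc_mat[OF a(1) M])
  show "resolvent n s X - s \<cdot>\<^sub>m (X * resolvent n s X) = 1\<^sub>m n"
    using r X c by (simp add: minus_mult_distrib_mat[where nr=n and n=n and nc=n] mult_smult_assoc_mat[where nr=n and n=n and nc=n])
  show "resolvent n s X - s \<cdot>\<^sub>m (resolvent n s X * X) = 1\<^sub>m n"
    using l X c by (simp add: mult_minus_distrib_mat[where nr=n and n=n and nc=n] mult_smult_distrib[where nr=n and n=n and nc=n])
qed

text \<open>From \<open>X^T (1 - X) = - (1 - X)^T\<close> and \<open>det X = 1\<close> one gets
  \<open>det (1 - X) = (-1)^n det (1 - X)\<close>, which vanishes for odd \<open>n\<close>. So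
  \<open>X\<close> fixes some vector \<open>v\<close>, and \<open>V\<close> is the orthogonal
  projection onto the line through \<open>v\<close>.\<close>

lemma SO_eigenprojection:
  assumes X: "X \<in> SO n" and n: "odd n"
  obtains V where "V \<in> carrier_mat n n" "transpose_mat V = V" "X * V = V" "V * X = V"
    "frob n V V = 1" "frob n V (1\<^sub>m n) = 1"
proof -
  have Xc: "X \<in> carrier_mat n n" and XT: "transpose_mat X * X = 1\<^sub>m n" "X * transpose_mat X = 1\<^sub>m n"
    and d: "Determinant.det X = 1" using X by (auto simp: SO_def)
  let ?M = "1\<^sub>m n - X"
  have M: "?M \<in> carrier_mat n n" using Xc by (simp add: minus_carrier_mat)
  have "transpose_mat X * ?M = transpose_mat ((- 1) \<cdot>\<^sub>m ?M)"
    using Xc XT by (subst mult_minus_distrib_mat[where nr=n and n=n and nc=n]) auto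
  then have "Determinant.det (transpose_mat X) * Determinant.det ?M = Determinant.det (transpose_mat ((- 1) \<cdot>\<^sub>m ?M))"
    using Xc M by (subst Determinant.det_mult[symmetric, where n=n]) auto
  then have "Determinant.det ?M = (-1) ^ n * Determinant.det ?M"
    using Xc M d by (subst (asm) (1 2) Determinant.det_transpose[where n=n]) (auto simp: det_smult)
  then have "Determinant.det ?M = 0" using n by simp
  then obtain v where v: "v \<in> carrier_vec n" "v \<noteq> 0\<^sub>v n" "?M *\<^sub>v v = 0\<^sub>v n"
    by (auto simp: det_0_iff_vec_prod_zero_field[OF M])
  have Xv: "(\<Sum>k<n. X $$ (i,k) * vec_index v k) = vec_index v i" if "i < n" for i
  proof -
    have "vec_index (?M *\<^sub>v v) i = (\<Sum>k<n. ((if i = k then 1 else 0) - X $$ (i,k)) * vec_index v k)"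
      using that Xc v(1) by (auto simp: scalar_prod_def lessThan_atLeast0 intro!: sum.cong)
    also have "\<dots> = vec_index v i - (\<Sum>k<n. X $$ (i,k) * vec_index v k)"
      using that by (simp add: left_diff_distrib sum_subtractf if_distrib[where f="\<lambda>x. x * _"] cong: if_cong)
    finally show ?thesis using v that by simp
  qed
  define q where "q = (\<Sum>k<n. (vec_index v k)\<^sup>2)"
  have q: "q > 0"
  proof -
    obtain i where "i < n" "vec_index v i \<noteq> 0"
      using v(1,2) by (metis carrier_vecD eq_vecI index_zero_vec)
    then show ?thesis unfolding q_def by (intro sum_pos2[of _ i]) auto
  qed
  define V where "V = mat n n (\<lambda>(i, j). vec_index v i * vec_index v j / q)"
  have V: "V \<in> carrier_mat n n" by (simp add: V_def)
  have VT: "transpose_mat V = V" by (intro eq_matI) (auto simp: V_def)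
  have XV: "X * V = V"
  proof (rule eq_matI)
    fix i j assume "i < dim_row V" "j < dim_col V"
    then have ij: "i < n" "j < n" using V by auto
    have "(X * V) $$ (i,j) = (\<Sum>k<n. X $$ (i,k) * vec_index v k) * vec_index v j / q"
      using ij by (simp only: index_mult[OF Xc V ij]) (simp add: V_def sum_distrib_right sum_divide_distrib mult.assoc)
    then show "(X * V) $$ (i,j) = V $$ (i,j)" using Xv ij by (simp add: V_def)
  qed (use Xc V in auto)
  \<comment> \<open>\<open>X^T\<close> fixes \<open>V\<close> as well; transposing this and using
    the symmetry of \<open>V\<close> gives \<open>V * X = V\<close>.\<close>
  have "transpose_mat X * (X * V) = V"
    using Xc V XT by (simp add: assoc_mult_mat[symmetric, where n\<^sub>2=n and n\<^sub>3=n and n\<^sub>4=n])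
  then have "transpose_mat X * V = V" using XV by simp
  then have "transpose_mat (transpose_mat X * V) = transpose_mat V" by simp
  then have VX: "V * X = V" using Xc V VT by (simp add: transpose_mult[where nr=n and n=n and nc=n])
  have t: "frob n V (1\<^sub>m n) = 1"
    using q by (simp add: frob_one V_def sum_divide_distrib[symmetric] power2_eq_square[symmetric] q_def[symmetric])
  have "frob n V V = (\<Sum>i<n. \<Sum>j<n. (vec_index v i)\<^sup>2 * (vec_index v j)\<^sup>2) / q\<^sup>2"
    by (simp add: frob_def V_def sum_divide_distrib power2_eq_square ac_simps)
  also have "\<dots> = (q * q) / q\<^sup>2"
    by (simp add: q_def sum_product)
  finally have "frob n V V = 1" using q by (simp add: power2_eq_square)
  then show thesis using that V VT XV VX t by blast
qed

lemma transpose_smult_mat: "transpose_mat (c \<cdot>\<^sub>m A) = c \<cdot>\<^sub>m transpose_mat A"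
  by (intro eq_matI) auto

lemma transpose_SO: "X \<in> SO n \<Longrightarrow> transpose_mat X \<in> SO n"
  by (auto simp: SO_def Determinant.det_transpose)

section \<open>Norm identities and bounds for the resolvent on SO(n)\<close>

context
  fixes n :: nat and s :: real and X B :: "real mat"
  assumes X: "X \<in> SO n" and s: "0 < s" "s < 1"
  defines "B \<equiv> resolvent n s X"
begin

private lemma Xc: "X \<in> carrier_mat n n" and XT: "transpose_mat X * X = 1\<^sub>m n" "X * transpose_mat X = 1\<^sub>m n"
  using X by (auto simp: SO_def)

private lemma Bc: "B \<in> carrier_mat n n"
  unfolding B_def using Xc XT s by (intro resolvent_carrier) auto

private lemma B1: "B - s \<cdot>\<^sub>m (X * B) = 1\<^sub>m n" and B2: "B - s \<cdot>\<^sub>m (B * X) = 1\<^sub>m n"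
  unfolding B_def using Xc XT s by (auto intro!: resolvent_eq1 resolvent_eq2)

private lemma B1': "s \<cdot>\<^sub>m (X * B) = B - 1\<^sub>m n" and B2': "s \<cdot>\<^sub>m (B * X) = B - 1\<^sub>m n"
proof -
  have *: "A - C = 1\<^sub>m n \<Longrightarrow> A \<in> carrier_mat n n \<Longrightarrow> C \<in> carrier_mat n n \<Longrightarrow> C = A - 1\<^sub>m n" for A C :: "real mat"
    by (drule sym) (auto intro!: eq_matI)
  show "s \<cdot>\<^sub>m (X * B) = B - 1\<^sub>m n" "s \<cdot>\<^sub>m (B * X) = B - 1\<^sub>m n"
    using *[OF B1] *[OF B2] Xc Bc by auto
qed

text \<open>Take squared norms in \<open>s X B = B - 1\<close>, where \<open>X\<close> acts as an
  isometry.\<close>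

lemma resolvent_frob: "(1 - s\<^sup>2) * frob n B B = 2 * frob n B (1\<^sub>m n) - real n"
proof -
  have "s\<^sup>2 * frob n B B = frob n (s \<cdot>\<^sub>m (X * B)) (s \<cdot>\<^sub>m (X * B))"
    using Xc Bc by (simp add: frob_smult frob_smult_right frob_isometry[OF Xc XT(1)] power2_eq_square)
  also have "\<dots> = frob n B B - 2 * frob n B (1\<^sub>m n) + n"
    unfolding B1' using Bc by (simp add: frob_diff frob_diff_right frob_one_one frob_sym[of n "1\<^sub>m n" B])
  finally show ?thesis by (simp add: algebra_simps)
qed

private lemma smult_sq: "A \<in> carrier_mat n n \<Longrightarrow> B' \<in> carrier_mat n n \<Longrightarrow>
  (s \<cdot>\<^sub>m A) * (s \<cdot>\<^sub>m B') = s\<^sup>2 \<cdot>\<^sub>m (A * B')"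
  by (intro eq_matI) (auto simp: power2_eq_square)

text \<open>Multiply \<open>s B X = B - 1\<close> by its transpose: the factor \<open>X X^T\<close>
  cancels and leaves \<open>s^2 B B^T = (B - 1) (B - 1)^T\<close>. The other order uses
  \<open>s X B = B - 1\<close>. In particular \<open>B\<close> commutes with its transpose.\<close>

lemma resolvent_mult_transpose:
  "(1 - s\<^sup>2) \<cdot>\<^sub>m (B * transpose_mat B) = B + transpose_mat B - 1\<^sub>m n"
  "(1 - s\<^sup>2) \<cdot>\<^sub>m (transpose_mat B * B) = B + transpose_mat B - 1\<^sub>m n"
proof -
  let ?T = "transpose_mat"
  note simps = minus_mult_distrib_mat[where nr=n and n=n and nc=n] mult_minus_distrib_mat[where nr=n and n=n and nc=n]
  have BT: "?T B \<in> carrier_mat n n" using Bc by simp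
  have aux: "(1 - s\<^sup>2) \<cdot>\<^sub>m P = B + ?T B - 1\<^sub>m n"
    if "s\<^sup>2 \<cdot>\<^sub>m P = P - ?T B - (B - 1\<^sub>m n)" "P \<in> carrier_mat n n" for P
  proof (rule eq_matI)
    fix i j assume "i < dim_row (B + ?T B - 1\<^sub>m n)" "j < dim_col (B + ?T B - 1\<^sub>m n)"
    then have ij: "i < n" "j < n" by auto
    have "(s\<^sup>2 \<cdot>\<^sub>m P) $$ (i,j) = (P - ?T B - (B - 1\<^sub>m n)) $$ (i,j)" using that by simp
    then show "((1 - s\<^sup>2) \<cdot>\<^sub>m P) $$ (i,j) = (B + ?T B - 1\<^sub>m n) $$ (i,j)"
      using ij that(2) Bc by (simp add: left_diff_distrib)
  qed (use that Bc in auto)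
  have "s\<^sup>2 \<cdot>\<^sub>m (B * ?T B) = (s \<cdot>\<^sub>m (B * X)) * (s \<cdot>\<^sub>m (?T X * ?T B))"
  proof -
    have "B * X * (?T X * ?T B) = B * (X * ?T X * ?T B)"
      using Xc Bc by (simp add: assoc_mult_mat[where n\<^sub>1=n and n\<^sub>2=n and n\<^sub>3=n and n\<^sub>4=n])
    then show ?thesis using Xc Bc XT by (simp add: smult_sq)
  qed
  also have "\<dots> = (B - 1\<^sub>m n) * ?T (B - 1\<^sub>m n)"
    using Xc Bc B2' by (metis transpose_mult transpose_smult_mat)
  also have "\<dots> = (B - 1\<^sub>m n) * (?T B - 1\<^sub>m n)"
    using Bc by (subst transpose_minus[where nr=n and nc=n]) auto
  also have "\<dots> = B * ?T B - ?T B - (B - 1\<^sub>m n)"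
    using Bc by (simp add: simps minus_carrier_mat)
  finally show "(1 - s\<^sup>2) \<cdot>\<^sub>m (B * ?T B) = B + ?T B - 1\<^sub>m n"
    using aux Bc by simp
  have "s\<^sup>2 \<cdot>\<^sub>m (?T B * B) = (s \<cdot>\<^sub>m (?T B * ?T X)) * (s \<cdot>\<^sub>m (X * B))"
  proof -
    have "?T B * ?T X * (X * B) = ?T B * (?T X * X * B)"
      using Xc Bc by (simp add: assoc_mult_mat[where n\<^sub>1=n and n\<^sub>2=n and n\<^sub>3=n and n\<^sub>4=n])
    then show ?thesis using Xc Bc XT by (simp add: smult_sq)
  qed
  also have "\<dots> = ?T (B - 1\<^sub>m n) * (B - 1\<^sub>m n)"
    using Xc Bc B1' by (metis transpose_mult transpose_smult_mat)
  also have "\<dots> = (?T B - 1\<^sub>m n) * (B - 1\<^sub>m n)"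
    using Bc by (subst transpose_minus[where nr=n and nc=n]) auto
  also have "\<dots> = ?T B * B - ?T B - (B - 1\<^sub>m n)"
  proof -
    have "(?T B - 1\<^sub>m n) * (B - 1\<^sub>m n) = (?T B * B - ?T B) - (B - 1\<^sub>m n)"
      using Bc by (simp add: simps minus_carrier_mat) (auto intro!: eq_matI)
    then show ?thesis by simp
  qed
  finally show "(1 - s\<^sup>2) \<cdot>\<^sub>m (?T B * B) = B + ?T B - 1\<^sub>m n"
    using aux Bc by simp
qed

private lemma Cc: "B - transpose_mat B \<in> carrier_mat n n"
proof (rule minus_carrier_mat)
  show "transpose_mat B \<in> carrier_mat n n" using Bc by (rule transpose_carrier_mat[THEN iffD2])
qed

text \<open>As \<open>B\<close> is normal, the antisymmetric part of \<open>B B - B\<close> factors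
  as \<open>(B - B^T) (B + B^T - 1)\<close>, whose second factor is \<open>(1 - s^2) B B^T\<close>.
  Moving \<open>B^T\<close> across the Frobenius product completes a square.\<close>

lemma resolvent_commutator:
  "frob n (B - transpose_mat B) ((B - 1\<^sub>m n) * B - transpose_mat ((B - 1\<^sub>m n) * B)) = (1 - s\<^sup>2) * frob n ((B - transpose_mat B) * B) ((B - transpose_mat B) * B)"
proof -
  let ?T = "transpose_mat"
  have BT: "?T B \<in> carrier_mat n n" using Bc by simp
  have s2: "1 - s\<^sup>2 \<noteq> 0" using s by (simp add: power2_eq_1_iff)
  have comm: "B * ?T B = ?T B * B"
  proof (rule eq_matI)
    fix i j assume ij: "i < dim_row (?T B * B)" "j < dim_col (?T B * B)"
    have "(1 - s\<^sup>2) \<cdot>\<^sub>m (B * ?T B) = (1 - s\<^sup>2) \<cdot>\<^sub>m (?T B * B)"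
      by (simp add: resolvent_mult_transpose)
    then have "((1 - s\<^sup>2) \<cdot>\<^sub>m (B * ?T B)) $$ (i,j) = ((1 - s\<^sup>2) \<cdot>\<^sub>m (?T B * B)) $$ (i,j)" by simp
    then show "(B * ?T B) $$ (i,j) = (?T B * B) $$ (i,j)" 
      using ij Bc s2 by (simp del: index_mult_mat(1))
  qed (use Bc in auto)
  have Z: "(B - 1\<^sub>m n) * B = B * B - B"
    using Bc by (simp add: minus_mult_distrib_mat[where nr=n and n=n and nc=n])
  have "?T (B * B - B) = ?T B * ?T B - ?T B"
    using Bc by (simp add: transpose_minus[where nr=n and nc=n] transpose_mult[where nr=n and n=n and nc=n])
  moreover have "(B - ?T B) * (B + ?T B - 1\<^sub>m n) = B * B + B * ?T B - B - (?T B * B + ?T B * ?T B - ?T B)"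
    using Bc BT by (simp add: minus_mult_distrib_mat[where nr=n and n=n and nc=n]
      mult_minus_distrib_mat[where nr=n and n=n and nc=n] mult_add_distrib_mat[where nr=n and n=n and nc=n] minus_carrier_mat)
      (intro eq_matI, auto simp del: index_mult_mat(1))
  moreover have "\<dots> = B * B - B - (?T B * ?T B - ?T B)"
    unfolding comm using Bc by (intro eq_matI) (auto simp del: index_mult_mat(1))
  ultimately have "(B - 1\<^sub>m n) * B - ?T ((B - 1\<^sub>m n) * B) = (B - ?T B) * (B + ?T B - 1\<^sub>m n)"
    unfolding Z by simp
  also have "\<dots> = (B - ?T B) * ((1 - s\<^sup>2) \<cdot>\<^sub>m (B * ?T B))" by (simp add: resolvent_mult_transpose)
  also have "\<dots> = (1 - s\<^sup>2) \<cdot>\<^sub>m ((B - ?T B) * B * ?T B)"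
    using Bc BT Cc by (simp add: mult_smult_distrib[where nr=n and n=n and nc=n] assoc_mult_mat[where n\<^sub>1=n and n\<^sub>2=n and n\<^sub>3=n and n\<^sub>4=n])
  finally show ?thesis
    using Bc BT Cc by (simp add: frob_smult_right frob_mult_right)
qed

text \<open>Apply \<open>frob_contraction\<close> to \<open>A * D\<close>, where \<open>A\<close>
  inverts \<open>1 - s Y\<close> for \<open>Y = X\<close> or \<open>Y = X^T\<close>. This is the
  operator norm bound \<open>1 / (1 - s)\<close> for \<open>B\<close> and
  \<open>B^T\<close>.\<close>

lemma resolvent_contraction:
  assumes D: "D \<in> carrier_mat n n"
  shows "(1 - s)\<^sup>2 * frob n (B * D) (B * D) \<le> frob n D D"
    and "(1 - s)\<^sup>2 * frob n (transpose_mat B * D) (transpose_mat B * D) \<le> frob n D D"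
proof -
  let ?T = "transpose_mat"
  have *: "(1 - s)\<^sup>2 * frob n (A * D) (A * D) \<le> frob n D D"
    if "Y \<in> carrier_mat n n" "?T Y * Y = 1\<^sub>m n" "A \<in> carrier_mat n n" "A - s \<cdot>\<^sub>m (Y * A) = 1\<^sub>m n" for A Y
  proof -
    have "A * D - s \<cdot>\<^sub>m (Y * (A * D)) = (A - s \<cdot>\<^sub>m (Y * A)) * D"
      using that(1,3) D by (simp add: minus_mult_distrib_mat[where nr=n and n=n and nc=n] mult_smult_assoc_mat[where nr=n and n=n and nc=n]
       assoc_mult_mat[where n\<^sub>1=n and n\<^sub>2=n and n\<^sub>3=n and n\<^sub>4=n])
    also have "\<dots> = D" using that D by simp
    finally show ?thesis using frob_contraction[OF that(1,2), of "A * D" s] that D s by simp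
  qed
  show "(1 - s)\<^sup>2 * frob n (B * D) (B * D) \<le> frob n D D"
    by (rule *[OF Xc XT(1) Bc B1])
  have "?T B - s \<cdot>\<^sub>m (?T X * ?T B) = ?T (B - s \<cdot>\<^sub>m (B * X))"
    using Xc Bc by (simp add: transpose_minus[where nr=n and nc=n] transpose_mult[where nr=n and n=n and nc=n] transpose_smult_mat)
  also have "\<dots> = 1\<^sub>m n" by (simp add: B2)
  finally show "(1 - s)\<^sup>2 * frob n (?T B * D) (?T B * D) \<le> frob n D D"
    using Xc XT Bc by (intro *[of "?T X"]) auto
qed

text \<open>A crude bound, uniform in \<open>X\<close>, that serves integrability and dominated
  convergence. It follows from the norm bound with \<open>D = 1\<close>; weakening \<open>n\<close>
  to \<open>n^2\<close> avoids a square root.\<close>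

lemma resolvent_entry_bound:
  assumes "i < n" "j < n"
  shows "\<bar>B $$ (i,j)\<bar> \<le> real n / (1 - s)"
proof -
  have "(B $$ (i,j))\<^sup>2 \<le> (\<Sum>j<n. (B $$ (i,j))\<^sup>2)"
    using assms by (intro member_le_sum) auto
  also have "\<dots> \<le> (\<Sum>i<n. \<Sum>j<n. (B $$ (i,j))\<^sup>2)"
    using assms by (intro member_le_sum[of i "{..<n}" "\<lambda>i. \<Sum>j<n. (B $$ (i,j))\<^sup>2"]) (auto intro!: sum_nonneg)
  also have "\<dots> = frob n B B" by (simp add: frob_def power2_eq_square)
  finally have "(1 - s)\<^sup>2 * (B $$ (i,j))\<^sup>2 \<le> (1 - s)\<^sup>2 * frob n B B"
    by (intro mult_left_mono) auto
  also have "\<dots> \<le> real n"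
    using resolvent_contraction(1)[of "1\<^sub>m n"] Bc by (simp add: frob_one_one)
  also have "\<dots> \<le> (real n)\<^sup>2"
    using assms by (simp add: power2_eq_square)
  finally have "\<bar>(1 - s) * B $$ (i,j)\<bar> \<le> \<bar>real n\<bar>"
    unfolding abs_le_square_iff by (simp add: power_mult_distrib)
  then show ?thesis using s by (simp add: field_simps abs_mult)
qed

text \<open>Subtracting the eigenprojection \<open>V\<close> for the eigenvalue 1 from the resolvent leaves a matrix \<open>D\<close> whose
  squared Frobenius norm is \<open>2 \<tau> / (1 - s\<^sup>2)\<close>, and \<open>B - B\<^sup>T\<close> does not see \<open>V\<close>.\<close>

lemma resolvent_defect:
  assumes n: "n = 2 * N + 1"
  defines "\<tau> \<equiv> frob n B (1\<^sub>m n) - 1 / (1 - s) - real N"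
  shows "\<tau> \<ge> 0"
    and "frob n (B - transpose_mat B) ((B - 1\<^sub>m n) * B - transpose_mat ((B - 1\<^sub>m n) * B)) \<le> 8 * \<tau> / (1 - s)\<^sup>2"
proof -
  let ?T = "transpose_mat"
  obtain V where V: "V \<in> carrier_mat n n" "?T V = V" "X * V = V" "V * X = V"
    "frob n V V = 1" "frob n V (1\<^sub>m n) = 1"
    using SO_eigenprojection[OF X] n by auto
  have s1: "1 - s \<noteq> 0" "1 - s\<^sup>2 > 0" using s by (auto simp: power2_eq_1_iff power_less_one_iff abs_square_less_1)
  define r where "r = 1 / (1 - s)"
  \<comment> \<open>Both \<open>B * V\<close> and \<open>V * B\<close> satisfy this equation, since
    \<open>X\<close> fixes \<open>V\<close> on either side.\<close>
  have aux: "W = r \<cdot>\<^sub>m V" if W: "W \<in> carrier_mat n n" and e: "W - s \<cdot>\<^sub>m W = V" for W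
  proof (rule eq_matI)
    fix i j assume "i < dim_row (r \<cdot>\<^sub>m V)" "j < dim_col (r \<cdot>\<^sub>m V)"
    then have ij: "i < n" "j < n" using V by auto
    have "(W - s \<cdot>\<^sub>m W) $$ (i,j) = V $$ (i,j)" using e by simp
    then have "(1 - s) * W $$ (i,j) = V $$ (i,j)" using W ij by (simp add: algebra_simps)
    then show "W $$ (i,j) = (r \<cdot>\<^sub>m V) $$ (i,j)" using W V ij s1 by (simp add: r_def field_simps)
  qed (use W V in auto)
  have "B * V - s \<cdot>\<^sub>m (B * V) = (B - s \<cdot>\<^sub>m (B * X)) * V"
    using Bc Xc V by (simp add: minus_mult_distrib_mat[where nr=n and n=n and nc=n] mult_smult_assoc_mat[where nr=n and n=n and nc=n]
       assoc_mult_mat[where n\<^sub>1=n and n\<^sub>2=n and n\<^sub>3=n and n\<^sub>4=n])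
  then have BV: "B * V = r \<cdot>\<^sub>m V" using B2 V Bc by (intro aux) auto
  have "V * B - s \<cdot>\<^sub>m (V * B) = V * (B - s \<cdot>\<^sub>m (X * B))"
    using Bc Xc V by (simp add: mult_minus_distrib_mat[where nr=n and n=n and nc=n] mult_smult_distrib[where nr=n and n=n and nc=n]
       assoc_mult_mat[symmetric, where n\<^sub>1=n and n\<^sub>2=n and n\<^sub>3=n and n\<^sub>4=n])
  then have VB: "V * B = r \<cdot>\<^sub>m V" using B1 V Bc by (intro aux) auto
  have "?T B * V = ?T (V * B)" using V Bc by (simp add: transpose_mult[where nr=n and n=n and nc=n])
  also have "\<dots> = r \<cdot>\<^sub>m V" using VB V by (simp add: transpose_smult_mat)
  finally have BTV: "?T B * V = r \<cdot>\<^sub>m V" .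
  define D where "D = B - r \<cdot>\<^sub>m V"
  have D: "D \<in> carrier_mat n n" using V by (simp add: D_def minus_carrier_mat)
  have BVr: "frob n B V = r"
  proof -
    have "frob n (B * V) (1\<^sub>m n) = frob n B V"
      using Bc V by (subst frob_mult_right) auto
    then show ?thesis using V by (simp add: BV frob_smult)
  qed
  have FD: "frob n D D = frob n B B - r\<^sup>2"
    using Bc V BVr by (simp add: D_def frob_diff frob_diff_right frob_smult frob_smult_right frob_sym[of n V B] power2_eq_square)
  \<comment> \<open>Square \<open>s r = r - 1\<close>.\<close>
  have r2: "(1 - s\<^sup>2) * r\<^sup>2 = 2 * r - 1"
  proof -
    have "s * r = r - 1" using s1(1) by (simp add: r_def field_simps)
    then have "(s * r)\<^sup>2 = (r - 1)\<^sup>2" by simp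
    then show ?thesis by (simp add: power_mult_distrib left_diff_distrib power2_diff)
  qed
  \<comment> \<open>The difference of \<open>2 tr B - n\<close> and \<open>2 r - 1\<close> is
    \<open>2 (tr B - r - N)\<close> because \<open>n = 2 N + 1\<close>.\<close>
  have Dt: "(1 - s\<^sup>2) * frob n D D = 2 * \<tau>"
    unfolding FD right_diff_distrib r2 resolvent_frob by (simp add: \<tau>_def r_def) (simp add: n)
  then show t: "\<tau> \<ge> 0" using frob_nonneg[of n D] s1(2)
    by (metis mult_nonneg_nonneg less_imp_le zero_le_mult_iff zero_less_numeral not_less)
  have CD: "(B - ?T B) * B = B * D - ?T B * D"
  proof -
    have "B * D - ?T B * D = B * B - B * (r \<cdot>\<^sub>m V) - (?T B * B - ?T B * (r \<cdot>\<^sub>m V))"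
      using Bc V by (simp add: D_def mult_minus_distrib_mat[where nr=n and n=n and nc=n])
    also have "\<dots> = B * B - r \<cdot>\<^sub>m (r \<cdot>\<^sub>m V) - (?T B * B - r \<cdot>\<^sub>m (r \<cdot>\<^sub>m V))"
      using Bc V by (simp add: mult_smult_distrib[where nr=n and n=n and nc=n] BV BTV)
    also have "\<dots> = B * B - ?T B * B"
      using Bc V by (intro eq_matI) (auto simp del: index_mult_mat(1))
    finally show ?thesis using Bc by (simp add: minus_mult_distrib_mat[where nr=n and n=n and nc=n])
  qed
  have parallel: "frob n (P - Q) (P - Q) \<le> 2 * frob n P P + 2 * frob n Q Q"
    if "P \<in> carrier_mat n n" "Q \<in> carrier_mat n n" for P Q
    using frob_nonneg[of n "P + Q"] that
    by (simp add: frob_diff frob_diff_right frob_add frob_add_right frob_sym[of n Q P])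
  \<comment> \<open>The parallelogram inequality and the two contractions give the factor 4; it
    becomes 8 through \<open>(1 - s^2) * frob n D D = 2 * \<tau>\<close>.\<close>
  have "(1 - s)\<^sup>2 * frob n ((B - transpose_mat B) * B) ((B - transpose_mat B) * B) \<le> 2 * ((1 - s)\<^sup>2 * frob n (B * D) (B * D)) + 2 * ((1 - s)\<^sup>2 * frob n (?T B * D) (?T B * D))"
    unfolding CD using mult_left_mono[OF parallel[of "B * D" "?T B * D"], of "(1 - s)\<^sup>2"] Bc D by (simp add: algebra_simps)
  also have "\<dots> \<le> 4 * frob n D D"
    using resolvent_contraction[OF D] by simp
  finally have "(1 - s\<^sup>2) * ((1 - s)\<^sup>2 * frob n ((B - transpose_mat B) * B) ((B - transpose_mat B) * B)) \<le> (1 - s\<^sup>2) * (4 * frob n D D)"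
    using s1 by (intro mult_left_mono) auto
  also have "\<dots> = 4 * ((1 - s\<^sup>2) * frob n D D)" by simp
  also have "\<dots> = 8 * \<tau>" unfolding Dt by simp
  finally have "(1 - s)\<^sup>2 * ((1 - s\<^sup>2) * frob n ((B - transpose_mat B) * B) ((B - transpose_mat B) * B)) \<le> 8 * \<tau>" by (simp add: algebra_simps)
  then show "frob n (B - transpose_mat B) ((B - 1\<^sub>m n) * B - transpose_mat ((B - 1\<^sub>m n) * B)) \<le> 8 * \<tau> / (1 - s)\<^sup>2"
    unfolding resolvent_commutator using s1(1) by (simp add: field_simps)
qed

end

subsection \<open>Plane rotations and Jacobi's formula\<close>

lemma SO_mult:
  assumes "G \<in> SO n" "X \<in> SO n"
  shows "G * X \<in> SO n"
proof -
  have c: "G \<in> carrier_mat n n" "X \<in> carrier_mat n n" using assms by (auto simp: SO_def)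
  have "G * X * (transpose_mat X * transpose_mat G) = G * (X * transpose_mat X) * transpose_mat G"
    using c by (simp add: assoc_mult_mat[where n\<^sub>1=n and n\<^sub>2=n and n\<^sub>3=n and n\<^sub>4=n])
  moreover have "transpose_mat X * transpose_mat G * (G * X) = transpose_mat X * (transpose_mat G * G) * X"
    using c by (simp add: assoc_mult_mat[where n\<^sub>1=n and n\<^sub>2=n and n\<^sub>3=n and n\<^sub>4=n])
  ultimately show ?thesis
    using assms c by (auto simp: SO_def transpose_mult[where nr=n and n=n and nc=n] Determinant.det_mult[where n=n])
qed

text \<open>For distinct \<open>i\<close> and \<open>j\<close>, a one-parameter group of rotations
  whose derivative at \<open>t = 0\<close> is the skew matrix with entry 1 at \<open>(i,j)\<close>
  and -1 at \<open>(j,i)\<close>.\<close>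

definition givens :: "nat \<Rightarrow> nat \<Rightarrow> nat \<Rightarrow> real \<Rightarrow> real mat" where
  "givens n i j t = mat n n (\<lambda>(k, l).
     if k = i then (if l = i then cos t else if l = j then sin t else 0)
     else if k = j then (if l = i then - sin t else if l = j then cos t else 0)
     else if k = l then 1 else 0)"

lemma givens_carrier [simp]: "givens n i j t \<in> carrier_mat n n"
  by (simp add: givens_def)

lemma givens_sum:
  assumes "i < n" "j < n" "i \<noteq> j" "k < n"
  shows "(\<Sum>l<n. givens n i j t $$ (k, l) * f l) =
    (if k = i then cos t * f i + sin t * f j
     else if k = j then - sin t * f i + cos t * f j else f k)"
proof -
  have "(\<Sum>l<n. givens n i j t $$ (k, l) * f l) =
     (\<Sum>l<n. (if l = i then (if k = i then cos t * f i else if k = j then - sin t * f i else 0) else 0)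
       + (if l = j then (if k = i then sin t * f j else if k = j then cos t * f j else 0) else 0)
       + (if l = k then (if k = i \<or> k = j then 0 else f k) else 0))"
    using assms by (intro sum.cong) (auto simp: givens_def)
  then show ?thesis using assms by (simp add: sum.distrib)
qed

lemma givens_mult_entry:
  assumes "i < n" "j < n" "i \<noteq> j" "k < n" "l < n" "A \<in> carrier_mat n n"
  shows "(givens n i j t * A) $$ (k, l) =
    (if k = i then cos t * A $$ (i,l) + sin t * A $$ (j,l)
     else if k = j then - sin t * A $$ (i,l) + cos t * A $$ (j,l) else A $$ (k,l))"
  using assms by (simp only: index_mult[OF givens_carrier]) (rule givens_sum)

lemma givens_add:
  assumes "i < n" "j < n" "i \<noteq> j"
  shows "givens n i j t * givens n i j u = givens n i j (t + u)"
proof (rule eq_matI)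
  fix k l assume "k < dim_row (givens n i j (t + u))" "l < dim_col (givens n i j (t + u))"
  then have "k < n" "l < n" by (auto simp: givens_def)
  then show "(givens n i j t * givens n i j u) $$ (k,l) = givens n i j (t + u) $$ (k,l)"
    using assms unfolding givens_mult_entry[OF assms \<open>k < n\<close> \<open>l < n\<close> givens_carrier]
    by (auto simp: givens_def cos_add sin_add)
qed (auto simp: givens_def)

lemma givens_0: "givens n i j 0 = 1\<^sub>m n"
  by (intro eq_matI) (auto simp: givens_def)

lemma givens_transpose: "i \<noteq> j \<Longrightarrow> transpose_mat (givens n i j t) = givens n i j (- t)"
  by (intro eq_matI) (auto simp: givens_def)

lemma givens_SO:
  assumes "i < n" "j < n" "i \<noteq> j"
  shows "givens n i j t \<in> SO n"
proof -
  have det_sq: "Determinant.det (givens n i j u) * Determinant.det (givens n i j u) = 1" for u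
  proof -
    have "Determinant.det (givens n i j u * transpose_mat (givens n i j u)) = 1"
      using assms by (simp add: givens_transpose givens_add givens_0)
    then show ?thesis
      using Determinant.det_mult[of "givens n i j u" n "transpose_mat (givens n i j u)"]
        Determinant.det_transpose[of "givens n i j u" n] by simp
  qed
  \<comment> \<open>Orthogonality only gives determinant 1 or -1; halving the angle makes the
    determinant a square and so fixes the sign.\<close>
  have "givens n i j t = givens n i j (t/2) * givens n i j (t/2)"
    using assms by (simp add: givens_add)
  then have "Determinant.det (givens n i j t) = 1"
    using det_sq by (simp add: Determinant.det_mult[where n=n])
  then show ?thesis using assms by (auto simp: SO_def givens_transpose givens_add givens_0)
qed

text \<open>The resolvent identity \<open>B' - B = B' (s G X - s X) B\<close>, where
  \<open>s X B\<close> is replaced by \<open>B - 1\<close>.\<close>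

lemma resolvent_perturb:
  assumes X: "X \<in> SO n" and G: "G \<in> SO n" and s: "0 < s" "s < 1"
  shows "resolvent n s (G * X) - resolvent n s X
     = resolvent n s (G * X) * (G * (resolvent n s X - 1\<^sub>m n) - (resolvent n s X - 1\<^sub>m n))"
proof -
  have c: "G \<in> carrier_mat n n" "X \<in> carrier_mat n n" and GX: "G * X \<in> SO n" "G * X \<in> carrier_mat n n"
    using assms SO_mult[OF G X] by (auto simp: SO_def)
  let ?B = "resolvent n s X" and ?B' = "resolvent n s (G * X)"
  have B: "?B \<in> carrier_mat n n" "?B - s \<cdot>\<^sub>m (X * ?B) = 1\<^sub>m n"
    using X s c by (auto simp: SO_def intro!: resolvent_carrier resolvent_eq1)
  have B': "?B' \<in> carrier_mat n n" "?B' - s \<cdot>\<^sub>m (?B' * (G * X)) = 1\<^sub>m n"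
    using GX s by (auto simp: SO_def intro!: resolvent_carrier resolvent_eq2)
  have XB: "?B - 1\<^sub>m n = s \<cdot>\<^sub>m (X * ?B)"
    unfolding B(2)[symmetric] using B(1) c by (intro eq_matI) (auto simp del: index_mult_mat(1))
  note assoc = assoc_mult_mat[where n\<^sub>1=n and n\<^sub>2=n and n\<^sub>3=n and n\<^sub>4=n]
  have "?B' * (G * (?B - 1\<^sub>m n) - (?B - 1\<^sub>m n)) = ?B' * (G * (?B - 1\<^sub>m n)) - ?B' * (?B - 1\<^sub>m n)"
    using B B' c by (intro mult_minus_distrib_mat[where nr=n and n=n and nc=n]) (auto simp: minus_carrier_mat)
  also have "?B' * (G * (?B - 1\<^sub>m n)) = (s \<cdot>\<^sub>m (?B' * (G * X))) * ?B"
    unfolding XB using B(1) B'(1) c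
    by (simp add: mult_smult_distrib[where nr=n and n=n and nc=n] mult_smult_assoc_mat[where nr=n and n=n and nc=n] assoc)
  also have "\<dots> = (?B' - 1\<^sub>m n) * ?B"
    unfolding B'(2)[symmetric] using B'(1) c
    by (intro arg_cong2[where f="(*)"] eq_matI) (auto simp del: index_mult_mat(1))
  also have "\<dots> - ?B' * (?B - 1\<^sub>m n) = (?B' * ?B - ?B) - (?B' * ?B - ?B')"
    using B(1) B'(1) by (simp add: minus_mult_distrib_mat[where nr=n and n=n and nc=n] mult_minus_distrib_mat[where nr=n and n=n and nc=n])
  also have "\<dots> = ?B' - ?B"
    using B(1) B'(1) by (intro eq_matI) (auto simp del: index_mult_mat(1))
  finally show ?thesis ..
qed

text \<open>Only the rows \<open>i\<close> and \<open>j\<close> of \<open>G - 1\<close> are nonzero,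
  so the product in \<open>resolvent_perturb\<close> has two terms. Being exact, the formula yields
  both the Lipschitz bound and the derivative in \<open>t\<close>.\<close>

lemma resolvent_givens_entry:
  fixes t :: real
  assumes X: "X \<in> SO n" and ij: "i < n" "j < n" "i \<noteq> j" and s: "0 < s" "s < 1" and kl: "k < n" "l < n"
  defines "B \<equiv> resolvent n s X" and "B' \<equiv> resolvent n s (givens n i j t * X)"
  defines "V \<equiv> B - 1\<^sub>m n"
  shows "B' $$ (k,l) - B $$ (k,l) =
     B' $$ (k,i) * ((cos t - 1) * V $$ (i,l) + sin t * V $$ (j,l))
     + B' $$ (k,j) * ((cos t - 1) * V $$ (j,l) - sin t * V $$ (i,l))"
proof -
  let ?G = "givens n i j t"
  note G = givens_SO[OF ij, of t]
  have B: "B \<in> carrier_mat n n" and B': "B' \<in> carrier_mat n n"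
    using X SO_mult[OF G X] s by (auto simp: SO_def B_def B'_def intro!: resolvent_carrier)
  have V: "V \<in> carrier_mat n n" by (simp add: V_def minus_carrier_mat)
  have M: "?G * V - V \<in> carrier_mat n n" using V by (simp add: minus_carrier_mat)
  have "B' $$ (k,l) - B $$ (k,l) = (B' - B) $$ (k,l)" using B B' kl by simp
  also have "\<dots> = (B' * (?G * V - V)) $$ (k,l)"
    using resolvent_perturb[OF X G s] by (simp add: B_def B'_def V_def)
  also have "\<dots> = (\<Sum>u<n. B' $$ (k,u) * (?G * V - V) $$ (u,l))"
    by (rule index_mult[OF B' M kl])
  also have "\<dots> = (\<Sum>u<n. (if u = i then B' $$ (k,i) * ((cos t - 1) * V $$ (i,l) + sin t * V $$ (j,l)) else 0)
      + (if u = j then B' $$ (k,j) * ((cos t - 1) * V $$ (j,l) - sin t * V $$ (i,l)) else 0))"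
  proof (rule sum.cong)
    fix u assume "u \<in> {..<n}"
    then have u: "u < n" by simp
    have "(?G * V - V) $$ (u,l) = (?G * V) $$ (u,l) - V $$ (u,l)" using V u kl by simp
    then have e: "(?G * V - V) $$ (u,l) = (if u = i then (cos t - 1) * V $$ (i,l) + sin t * V $$ (j,l)
        else if u = j then (cos t - 1) * V $$ (j,l) - sin t * V $$ (i,l) else 0)"
      using ij by (auto simp: givens_mult_entry[OF ij u kl(2) V] left_diff_distrib)
    show "B' $$ (k,u) * (?G * V - V) $$ (u,l) = (if u = i then B' $$ (k,i) * ((cos t - 1) * V $$ (i,l) + sin t * V $$ (j,l)) else 0)
      + (if u = j then B' $$ (k,j) * ((cos t - 1) * V $$ (j,l) - sin t * V $$ (i,l)) else 0)"
      unfolding e using ij by auto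
  qed simp
  also have "\<dots> = B' $$ (k,i) * ((cos t - 1) * V $$ (i,l) + sin t * V $$ (j,l))
     + B' $$ (k,j) * ((cos t - 1) * V $$ (j,l) - sin t * V $$ (i,l))"
    using ij by (simp add: sum.distrib)
  finally show ?thesis .
qed

text \<open>Differentiate the Leibniz expansion termwise. Only the identity permutation contributes,
  since every other one has at least two factors that vanish at 0.\<close>

lemma det_one_minus_has_derivative:
  fixes Z :: "real mat"
  assumes Z: "Z \<in> carrier_mat n n"
  shows "((\<lambda>h. Determinant.det (1\<^sub>m n - h \<cdot>\<^sub>m Z)) has_real_derivative - (\<Sum>i<n. Z $$ (i,i))) (at 0)"
proof -
  define f where "f p i h = (if i = p i then 1 else 0) - h * Z $$ (i, p i)" for p :: "nat \<Rightarrow> nat" and i and h :: real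
  define P where "P = {p. p permutes {0..<n}}"
  have fin: "finite P" by (simp add: P_def finite_permutations)
  have det: "Determinant.det (1\<^sub>m n - h \<cdot>\<^sub>m Z) = (\<Sum>p\<in>P. signof p * (\<Prod>i = 0..<n. f p i h))" for h
  proof -
    have "Determinant.det (1\<^sub>m n - h \<cdot>\<^sub>m Z) = (\<Sum>p\<in>P. signof p * (\<Prod>i = 0..<n. (1\<^sub>m n - h \<cdot>\<^sub>m Z) $$ (i, p i)))"
      unfolding P_def using Z by (intro det_def') (simp add: minus_carrier_mat)
    also have "\<dots> = (\<Sum>p\<in>P. signof p * (\<Prod>i = 0..<n. f p i h))"
      using Z by (intro sum.cong arg_cong2[where f="(*)"] prod.cong refl)
        (auto simp: f_def P_def permutes_in_image[of _ "{0..<n}", simplified])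
    finally show ?thesis .
  qed
  have der: "((\<lambda>h. \<Prod>i = 0..<n. f p i h) has_real_derivative
      (\<Sum>i = 0..<n. (- Z $$ (i, p i)) * (\<Prod>k\<in>{0..<n} - {i}. f p k 0))) (at 0)" for p
    by (rule DERIV_cong, rule has_field_derivative_prod[where f'="\<lambda>i. - Z $$ (i, p i)"])
      (auto simp: f_def intro!: derivative_eq_intros)
  have val: "(\<Sum>i = 0..<n. (- Z $$ (i, p i)) * (\<Prod>k\<in>{0..<n} - {i}. f p k 0))
     = (if p = id then - (\<Sum>i<n. Z $$ (i,i)) else 0)" if "p \<in> P" for p
  proof (cases "p = id")
    case True
    then show ?thesis by (simp add: f_def sum_negf lessThan_atLeast0)
  next
    case False
    have p: "p permutes {0..<n}" using that by (simp add: P_def)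
    \<comment> \<open>Both \<open>k\<close> and \<open>p k\<close> are moved by \<open>p\<close>, so
      after removing any one index \<open>i\<close> a factor that vanishes at 0 remains.\<close>
    from False obtain k where k: "p k \<noteq> k" by (auto simp: fun_eq_iff)
    have kn: "k < n" using p k by (metis atLeastLessThan_iff permutes_not_in zero_le)
    have k2: "p (p k) \<noteq> p k" using p k by (metis permutes_inj inj_eq)
    have pkn: "p k < n" using p kn by (metis atLeastLessThan_iff permutes_in_image zero_le)
    have "(\<Prod>m\<in>{0..<n} - {i}. f p m 0) = 0" for i
    proof -
      have "k \<in> {0..<n} - {i} \<or> p k \<in> {0..<n} - {i}" using k kn pkn by auto
      moreover have "f p k 0 = 0" "f p (p k) 0 = 0" using k[symmetric] k2[symmetric] by (simp_all add: f_def)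
      ultimately have "\<exists>m\<in>{0..<n} - {i}. f p m 0 = 0" by blast
      then show ?thesis by (intro prod_zero) auto
    qed
    then show ?thesis using False by simp
  qed
  have "((\<lambda>h. \<Sum>p\<in>P. signof p * (\<Prod>i = 0..<n. f p i h)) has_real_derivative
     (\<Sum>p\<in>P. signof p * (\<Sum>i = 0..<n. (- Z $$ (i, p i)) * (\<Prod>k\<in>{0..<n} - {i}. f p k 0)))) (at 0)"
    by (intro DERIV_sum DERIV_cmult der)
  also have "(\<Sum>p\<in>P. signof p * (\<Sum>i = 0..<n. (- Z $$ (i, p i)) * (\<Prod>k\<in>{0..<n} - {i}. f p k 0)))
     = (\<Sum>p\<in>P. if p = id then - (\<Sum>i<n. Z $$ (i,i)) else 0)"
    by (intro sum.cong refl, subst val) auto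
  also have "\<dots> = - (\<Sum>i<n. Z $$ (i,i))"
    using fin by (simp add: P_def permutes_id)
  finally show ?thesis unfolding det .
qed

section \<open>The logarithmic derivative as a trace of the resolvent\<close>

lemma mat_adjoint_real: "mat_adjoint (X :: real mat) = transpose_mat X"
  by (intro eq_matI) (auto simp: mat_adjoint_def mat_of_rows_def)

lemma log_deriv_char_fun:
  assumes X: "X \<in> SO n" and s: "0 < s" "s < 1"
  shows "log_deriv (char_fun X) s = - (frob n (resolvent n s X) (1\<^sub>m n) - real n) / s"
proof -
  let ?T = "transpose_mat" and ?B = "resolvent n s (transpose_mat X)"
  have c: "X \<in> carrier_mat n n" and XT: "?T X \<in> carrier_mat n n" "?T X \<in> SO n"
    using X transpose_SO[OF X] by (auto simp: SO_def)
  have B: "?B \<in> carrier_mat n n" "(1\<^sub>m n - s \<cdot>\<^sub>m ?T X) * ?B = 1\<^sub>m n" "?B - s \<cdot>\<^sub>m (?B * ?T X) = 1\<^sub>m n"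
    using XT s by (auto simp: SO_def intro!: resolvent_carrier resolvent_eq2 resolvent_right)
  have M: "1\<^sub>m n - s \<cdot>\<^sub>m ?T X \<in> carrier_mat n n" using XT(1) by (simp add: minus_carrier_mat)
  define d where "d = Determinant.det (1\<^sub>m n - s \<cdot>\<^sub>m ?T X)"
  define Z where "Z = ?B * ?T X"
  have Z: "Z \<in> carrier_mat n n" using B XT by (simp add: Z_def)
  have d0: "d \<noteq> 0" unfolding d_def using XT s by (intro det_one_minus_smult_ne_0) (auto simp: SO_def)
  have cf: "char_fun X u = Determinant.det (1\<^sub>m n - u \<cdot>\<^sub>m ?T X)" for u
    using c by (simp add: char_fun_def mat_adjoint_real)
  \<comment> \<open>Factoring \<open>1 - u X^T\<close> as \<open>(1 - s X^T) (1 - (u - s) Z)\<close>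
    moves the point of differentiation from \<open>s\<close> to 0, where the previous derivative
    applies.\<close>
  have fact: "char_fun X u = d * Determinant.det (1\<^sub>m n - (u - s) \<cdot>\<^sub>m Z)" for u
  proof -
    have "(1\<^sub>m n - s \<cdot>\<^sub>m ?T X) * (1\<^sub>m n - (u - s) \<cdot>\<^sub>m Z) = (1\<^sub>m n - s \<cdot>\<^sub>m ?T X) - (u - s) \<cdot>\<^sub>m ((1\<^sub>m n - s \<cdot>\<^sub>m ?T X) * Z)"
      using mult_minus_distrib_mat[OF M one_carrier_mat, of "(u - s) \<cdot>\<^sub>m Z"] mult_smult_distrib[OF M Z] right_mult_one_mat[OF M] Z by simp
    also have "(1\<^sub>m n - s \<cdot>\<^sub>m ?T X) * Z = ?T X"
      unfolding Z_def using M B(1,2) XT(1) by (simp add: assoc_mult_mat[symmetric, where n\<^sub>1=n and n\<^sub>2=n and n\<^sub>3=n and n\<^sub>4=n])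
    also have "(1\<^sub>m n - s \<cdot>\<^sub>m ?T X) - (u - s) \<cdot>\<^sub>m ?T X = 1\<^sub>m n - u \<cdot>\<^sub>m ?T X"
      using c by (intro eq_matI) (auto simp: left_diff_distrib)
    finally have "1\<^sub>m n - u \<cdot>\<^sub>m ?T X = (1\<^sub>m n - s \<cdot>\<^sub>m ?T X) * (1\<^sub>m n - (u - s) \<cdot>\<^sub>m Z)" ..
    then show ?thesis
      using M Z by (simp add: cf d_def Determinant.det_mult[where n=n] minus_carrier_mat)
  qed
  have "((\<lambda>h. d * Determinant.det (1\<^sub>m n - h \<cdot>\<^sub>m Z)) has_real_derivative d * - (\<Sum>i<n. Z $$ (i,i))) (at 0)"
    by (intro DERIV_cmult det_one_minus_has_derivative Z)
  then have "((\<lambda>h. char_fun X (h + s)) has_real_derivative d * - (\<Sum>i<n. Z $$ (i,i))) (at 0)"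
    by (simp add: fact)
  then have "(char_fun X has_real_derivative d * - (\<Sum>i<n. Z $$ (i,i))) (at s)"
    using DERIV_at_within_shift[of "char_fun X" _ s 0 UNIV] by (simp add: add.commute)
  then have "deriv (char_fun X) s = d * - (\<Sum>i<n. Z $$ (i,i))" by (rule DERIV_imp_deriv)
  moreover have "char_fun X s = d" using Z by (simp add: cf d_def)
  ultimately have "log_deriv (char_fun X) s = - frob n Z (1\<^sub>m n)"
    using d0 by (simp add: log_deriv_def frob_one)
  also have "s * frob n Z (1\<^sub>m n) = frob n ?B (1\<^sub>m n) - real n"
  proof -
    have "frob n (?B - s \<cdot>\<^sub>m Z) (1\<^sub>m n) = real n" using B by (simp add: Z_def frob_one_one)
    then show ?thesis using B Z by (simp add: frob_diff frob_smult)
  qed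
  then have "- frob n Z (1\<^sub>m n) = - (frob n ?B (1\<^sub>m n) - real n) / s"
    using s by (simp add: field_simps)
  \<comment> \<open>The adjoint in \<open>char_fun\<close> led to the resolvent of
    \<open>X^T\<close>. It is the transpose of that of \<open>X\<close> by uniqueness of inverses,
    so the traces agree.\<close>
  also have "?B = ?T (resolvent n s X)"
  proof -
    let ?R = "resolvent n s X"
    have R: "?R \<in> carrier_mat n n" "(1\<^sub>m n - s \<cdot>\<^sub>m X) * ?R = 1\<^sub>m n"
      using X c s by (auto simp: SO_def intro!: resolvent_carrier resolvent_right)
    have "?T ?R * (1\<^sub>m n - s \<cdot>\<^sub>m ?T X) = ?T ((1\<^sub>m n - s \<cdot>\<^sub>m X) * ?R)"
      using R(1) c by (simp add: transpose_mult[where nr=n and n=n and nc=n] transpose_minus[where nr=n and nc=n] minus_carrier_mat transpose_smult_mat)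
    also have "\<dots> = 1\<^sub>m n" using R by simp
    finally have l: "?T ?R * (1\<^sub>m n - s \<cdot>\<^sub>m ?T X) = 1\<^sub>m n" .
    have "?T ?R * ((1\<^sub>m n - s \<cdot>\<^sub>m ?T X) * ?B) = (?T ?R * (1\<^sub>m n - s \<cdot>\<^sub>m ?T X)) * ?B"
      using R(1) M B(1) by (simp add: assoc_mult_mat[where n\<^sub>1=n and n\<^sub>2=n and n\<^sub>3=n and n\<^sub>4=n])
    then show ?thesis using l B R by simp
  qed
  also have "frob n (?T (resolvent n s X)) (1\<^sub>m n) = frob n (resolvent n s X) (1\<^sub>m n)"
    using frob_transpose[OF resolvent_carrier[of X n s] one_carrier_mat] X s by (auto simp: SO_def)
  finally show ?thesis .
qed

subsection \<open>Invariance of Haar measure and the loop equation\<close>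

lemma measurable_SO_entry:
  assumes "i < n" "j < n"
  shows "(\<lambda>X. X $$ (i,j)) \<in> borel_measurable (borel_SO n)"
proof -
  let ?I = "{..<n} \<times> {..<n}"
  have "(\<lambda>X. \<lambda>ij\<in>?I. X $$ ij) \<in> measurable (borel_SO n) (PiM ?I (\<lambda>_. borel :: real measure))"
    unfolding borel_SO_def by (rule measurable_vimage_algebra1) (auto simp: space_PiM)
  moreover have "(\<lambda>f. f (i,j)) \<in> measurable (PiM ?I (\<lambda>_. borel :: real measure)) borel"
    using assms by (intro measurable_component_singleton) auto
  ultimately have "(\<lambda>X. (\<lambda>ij\<in>?I. X $$ ij) (i,j)) \<in> borel_measurable (borel_SO n)"
    by (rule measurable_compose)
  then show ?thesis using assms by simp
qed

text \<open>By the Leibniz formula the determinant is polynomial in the entries. The general form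
  covers both \<open>1 - s X\<close> and its minors.\<close>

lemma measurable_det:
  fixes f :: "'a \<Rightarrow> real mat"
  assumes c: "\<And>x. x \<in> space M \<Longrightarrow> f x \<in> carrier_mat m m"
    and e: "\<And>i j. i < m \<Longrightarrow> j < m \<Longrightarrow> (\<lambda>x. f x $$ (i,j)) \<in> borel_measurable M"
  shows "(\<lambda>x. Determinant.det (f x)) \<in> borel_measurable M"
proof (subst measurable_cong)
  show "Determinant.det (f x) = (\<Sum>p\<in>{p. p permutes {0..<m}}. signof p * (\<Prod>i = 0..<m. f x $$ (i, p i)))"
    if "x \<in> space M" for x
    using c[OF that] by (rule det_def')
  show "(\<lambda>x. \<Sum>p\<in>{p. p permutes {0..<m}}. signof p * (\<Prod>i = 0..<m. f x $$ (i, p i))) \<in> borel_measurable M"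
  proof (intro borel_measurable_sum borel_measurable_times borel_measurable_const borel_measurable_prod e)
    fix p i assume "p \<in> {p. p permutes {0..<m}}" "i \<in> {0..<m}"
    then show "i < m" "p i < m" using permutes_in_image[of p "{0..<m}" i] by auto
  qed
qed

lemma space_borel_SO: "space (borel_SO n) = SO n"
  by (simp add: borel_SO_def)

lemma measurable_resolvent:
  assumes ij: "i < n" "j < n"
  shows "(\<lambda>X. resolvent n s X $$ (i,j)) \<in> borel_measurable (borel_SO n)"
proof -
  let ?M = "\<lambda>X. 1\<^sub>m n - s \<cdot>\<^sub>m X"
  have SOc: "X \<in> carrier_mat n n" if "X \<in> SO n" for X using that by (auto simp: SO_def)
  have c: "?M X \<in> carrier_mat n n" if "X \<in> space (borel_SO n)" for X
    using SOc[of X] that by (simp add: space_borel_SO minus_carrier_mat)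
  have e: "(\<lambda>X. ?M X $$ (k,l)) \<in> borel_measurable (borel_SO n)" if "k < n" "l < n" for k l
  proof (subst measurable_cong)
    show "?M X $$ (k,l) = (if k = l then 1 else 0) - s * X $$ (k,l)" if "X \<in> space (borel_SO n)" for X
      using that SOc[of X] \<open>k < n\<close> \<open>l < n\<close> by (auto simp: space_borel_SO)
    show "(\<lambda>X. (if k = l then 1 else 0) - s * X $$ (k,l)) \<in> borel_measurable (borel_SO n)"
      using measurable_SO_entry[OF that] by measurable
  qed
  have d: "(\<lambda>X. Determinant.det (?M X)) \<in> borel_measurable (borel_SO n)"
    using c e by (rule measurable_det)
  have cof: "(\<lambda>X. Determinant.det (mat_delete (?M X) j i)) \<in> borel_measurable (borel_SO n)"
  proof (rule measurable_det)
    show "mat_delete (?M X) j i \<in> carrier_mat (n - 1) (n - 1)" if "X \<in> space (borel_SO n)" for X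
      using c[OF that] by (rule mat_delete_carrier)
    fix k l assume kl: "k < n - 1" "l < n - 1"
    \<comment> \<open>Deleting row \<open>j\<close> and column \<open>i\<close> shifts the later
      indices by one.\<close>
    define k' l' where "k' = (if k < j then k else Suc k)" and "l' = (if l < i then l else Suc l)"
    have kl': "k' < n" "l' < n" using kl by (auto simp: k'_def l'_def)
    show "(\<lambda>X. mat_delete (?M X) j i $$ (k,l)) \<in> borel_measurable (borel_SO n)"
    proof (subst measurable_cong)
      show "mat_delete (?M X) j i $$ (k,l) = ?M X $$ (k',l')" if "X \<in> space (borel_SO n)" for X
        using SOc[of X] that kl unfolding space_borel_SO mat_delete_def k'_def l'_def by auto
    qed (rule e[OF kl'])
  qed
  show ?thesis
  proof (subst measurable_cong)
    show "resolvent n s X $$ (i,j) = (1 / Determinant.det (?M X)) * ((-1) ^ (j + i) * Determinant.det (mat_delete (?M X) j i))"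
      if "X \<in> space (borel_SO n)" for X
      using SOc[of X] that ij by (auto simp: space_borel_SO resolvent_def adj_mat_def cofactor_def)
    show "(\<lambda>X. (1 / Determinant.det (?M X)) * ((-1) ^ (j + i) * Determinant.det (mat_delete (?M X) j i))) \<in> borel_measurable (borel_SO n)"
      using d cof by measurable
  qed
qed

lemma measurable_SO_mult:
  assumes G: "G \<in> SO n"
  shows "(\<lambda>X. G * X) \<in> measurable (borel_SO n) (borel_SO n)"
proof -
  let ?I = "{..<n} \<times> {..<n}"
  have "(\<lambda>X. \<lambda>ij\<in>?I. (G * X) $$ ij) \<in> measurable (borel_SO n) (PiM ?I (\<lambda>_. borel :: real measure))"
  proof (rule measurable_restrict)
    fix ij assume "ij \<in> ?I"
    then obtain i j where ij: "ij = (i,j)" "i < n" "j < n" by auto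
    show "(\<lambda>X. (G * X) $$ ij) \<in> borel_measurable (borel_SO n)"
    proof (subst measurable_cong)
      show "(G * X) $$ ij = (\<Sum>k<n. G $$ (i,k) * X $$ (k,j))" if "X \<in> space (borel_SO n)" for X
        using that G ij unfolding ij(1) by (intro index_mult) (auto simp: space_borel_SO SO_def)
      show "(\<lambda>X. \<Sum>k<n. G $$ (i,k) * X $$ (k,j)) \<in> borel_measurable (borel_SO n)"
        using ij by (intro borel_measurable_sum borel_measurable_times borel_measurable_const measurable_SO_entry) auto
    qed
  qed
  then show ?thesis
    by (subst (2) borel_SO_def, intro measurable_vimage_algebra2)
       (auto simp: space_borel_SO intro: SO_mult[OF G])
qed

lemma haar_integral_mult:
  fixes f :: "real mat \<Rightarrow> real"
  assumes h: "haar_prob_SO n \<mu>" and G: "G \<in> SO n" and f: "f \<in> borel_measurable \<mu>"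
  shows "(\<integral>X. f (G * X) \<partial>\<mu>) = (\<integral>X. f X \<partial>\<mu>)"
proof -
  have s: "sets \<mu> = sets (borel_SO n)" using h by (simp add: haar_prob_SO_def)
  have m: "(\<lambda>X. G * X) \<in> measurable \<mu> \<mu>"
    using measurable_SO_mult[OF G] by (simp add: measurable_cong_sets[OF s s])
  have "(\<integral>X. f X \<partial>\<mu>) = (\<integral>X. f X \<partial>(distr \<mu> \<mu> (\<lambda>X. G * X)))"
    using h G by (simp add: haar_prob_SO_def)
  also have "\<dots> = (\<integral>X. f (G * X) \<partial>\<mu>)" by (rule integral_distr[OF m f])
  finally show ?thesis ..
qed

text \<open>\<open>tame S F D\<close> packages what dominated convergence needs to differentiate
  \<open>\<integral>X. F t X\<close> at \<open>t = 0\<close>, in a form that is closed under products.\<close>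

definition tame :: "'a set \<Rightarrow> (real \<Rightarrow> 'a \<Rightarrow> real) \<Rightarrow> ('a \<Rightarrow> real) \<Rightarrow> bool" where
  "tame S F D \<longleftrightarrow>
     (\<exists>K. \<forall>X\<in>S. \<forall>t. \<bar>F t X\<bar> \<le> K \<and> \<bar>F t X - F 0 X\<bar> \<le> K * \<bar>t\<bar>) \<and>
     (\<forall>X\<in>S. ((\<lambda>t. F t X) has_real_derivative D X) (at 0))"

lemma tame_const: "tame S (\<lambda>_ _. c) (\<lambda>_. 0)"
  by (auto simp: tame_def intro!: exI[of _ "\<bar>c\<bar>"])

lemma tame_add:
  assumes "tame S F D" "tame S F' D'"
  shows "tame S (\<lambda>t X. F t X + F' t X) (\<lambda>X. D X + D' X)"
proof -
  from assms obtain K K' where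
    K: "\<And>X t. X \<in> S \<Longrightarrow> \<bar>F t X\<bar> \<le> K" "\<And>X t. X \<in> S \<Longrightarrow> \<bar>F t X - F 0 X\<bar> \<le> K * \<bar>t\<bar>" and
    K': "\<And>X t. X \<in> S \<Longrightarrow> \<bar>F' t X\<bar> \<le> K'" "\<And>X t. X \<in> S \<Longrightarrow> \<bar>F' t X - F' 0 X\<bar> \<le> K' * \<bar>t\<bar>"
    unfolding tame_def by metis
  show ?thesis unfolding tame_def
  proof (intro conjI exI[of _ "K + K'"] ballI allI)
    fix X t assume X: "X \<in> S"
    show "\<bar>F t X + F' t X\<bar> \<le> K + K'" using K(1)[OF X, of t] K'(1)[OF X, of t] by linarith
    show "\<bar>F t X + F' t X - (F 0 X + F' 0 X)\<bar> \<le> (K + K') * \<bar>t\<bar>"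
      using K(2)[OF X, of t] K'(2)[OF X, of t] by (simp add: distrib_right)
    show "((\<lambda>t. F t X + F' t X) has_real_derivative D X + D' X) (at 0)"
      using assms X by (auto simp: tame_def intro: DERIV_add)
  qed
qed

lemma tame_mult:
  assumes "tame S F D" "tame S F' D'"
  shows "tame S (\<lambda>t X. F t X * F' t X) (\<lambda>X. D X * F' 0 X + F 0 X * D' X)"
proof -
  from assms obtain K K' where
    K: "\<And>X t. X \<in> S \<Longrightarrow> \<bar>F t X\<bar> \<le> K" "\<And>X t. X \<in> S \<Longrightarrow> \<bar>F t X - F 0 X\<bar> \<le> K * \<bar>t\<bar>" and
    K': "\<And>X t. X \<in> S \<Longrightarrow> \<bar>F' t X\<bar> \<le> K'" "\<And>X t. X \<in> S \<Longrightarrow> \<bar>F' t X - F' 0 X\<bar> \<le> K' * \<bar>t\<bar>"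
    unfolding tame_def by metis
  show ?thesis unfolding tame_def
  \<comment> \<open>The factor 2 counts the two terms of the product difference. Absolute values are
    taken because for empty \<open>S\<close> nothing forces \<open>K\<close> and \<open>K'\<close>
    to be nonnegative.\<close>
  proof (intro conjI exI[of _ "2 * \<bar>K\<bar> * \<bar>K'\<bar>"] ballI allI)
    fix X t assume X: "X \<in> S"
    have b: "\<bar>F t X\<bar> \<le> \<bar>K\<bar>" "\<bar>F' 0 X\<bar> \<le> \<bar>K'\<bar>" "\<bar>F' t X\<bar> \<le> \<bar>K'\<bar>"
      using K(1)[OF X, of t] K'(1)[OF X, of 0] K'(1)[OF X, of t] by linarith+
    have l: "\<bar>F t X - F 0 X\<bar> \<le> \<bar>K\<bar> * \<bar>t\<bar>" "\<bar>F' t X - F' 0 X\<bar> \<le> \<bar>K'\<bar> * \<bar>t\<bar>"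
      using K(2)[OF X, of t] K'(2)[OF X, of t] by (meson abs_ge_self abs_ge_zero mult_right_mono order_trans)+
    show "\<bar>F t X * F' t X\<bar> \<le> 2 * \<bar>K\<bar> * \<bar>K'\<bar>"
    proof -
      have "\<bar>F t X * F' t X\<bar> \<le> \<bar>K\<bar> * \<bar>K'\<bar>"
        using mult_mono[OF b(1,3)] by (simp add: abs_mult)
      also have "\<dots> \<le> 2 * \<bar>K\<bar> * \<bar>K'\<bar>" by simp
      finally show ?thesis .
    qed
    have "F t X * F' t X - F 0 X * F' 0 X = F t X * (F' t X - F' 0 X) + (F t X - F 0 X) * F' 0 X"
      by (simp add: algebra_simps)
    also have "\<bar>\<dots>\<bar> \<le> \<bar>F t X\<bar> * \<bar>F' t X - F' 0 X\<bar> + \<bar>F t X - F 0 X\<bar> * \<bar>F' 0 X\<bar>"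
      by (metis abs_mult abs_triangle_ineq)
    also have "\<dots> \<le> \<bar>K\<bar> * (\<bar>K'\<bar> * \<bar>t\<bar>) + (\<bar>K\<bar> * \<bar>t\<bar>) * \<bar>K'\<bar>"
      by (intro add_mono mult_mono b l) auto
    finally show "\<bar>F t X * F' t X - F 0 X * F' 0 X\<bar> \<le> 2 * \<bar>K\<bar> * \<bar>K'\<bar> * \<bar>t\<bar>"
      by (simp add: algebra_simps)
    show "((\<lambda>t. F t X * F' t X) has_real_derivative D X * F' 0 X + F 0 X * D' X) (at 0)"
      using assms X by (auto simp: tame_def intro!: derivative_eq_intros)
  qed
qed

lemma tame_diff:
  assumes "tame S F D" "tame S F' D'"
  shows "tame S (\<lambda>t X. F t X - F' t X) (\<lambda>X. D X - D' X)"
  using tame_add[OF assms(1) tame_mult[OF tame_const[of S "-1"] assms(2)]] by simp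

lemma tame_sum:
  assumes "\<And>k. k \<in> A \<Longrightarrow> tame S (F k) (D k)"
  shows "tame S (\<lambda>t X. \<Sum>k\<in>A. F k t X) (\<lambda>X. \<Sum>k\<in>A. D k X)"
  using assms
proof (induction A rule: infinite_finite_induct)
  case (insert x A)
  then show ?case using tame_add[of S "F x" "D x"] by simp
qed (simp_all add: tame_const)

lemma tame_power:
  assumes "tame S F D"
  shows "tame S (\<lambda>t X. F t X ^ p) (\<lambda>X. real p * F 0 X ^ (p - 1) * D X)"
proof (induction p)
  case 0
  then show ?case by (simp add: tame_const)
next
  case (Suc p)
  \<comment> \<open>For \<open>p = 0\<close> the truncated exponent \<open>p - 1\<close> is
    harmless, as its coefficient is 0.\<close>
  have "D X * F 0 X ^ p + F 0 X * (real p * F 0 X ^ (p - 1) * D X) = real (Suc p) * F 0 X ^ (Suc p - 1) * D X" for X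
    by (cases p) (simp_all add: algebra_simps)
  then show ?case using tame_mult[OF assms Suc] by simp
qed

text \<open>Along \<open>t = 1 / (k + 1)\<close> the difference quotients have integral 0, are
  bounded by \<open>K\<close> and converge pointwise to \<open>D\<close>. The sequence also gives
  measurability of \<open>D\<close>, and dominated convergence does the rest.\<close>

lemma (in finite_measure) integral_tame_derivative:
  assumes F: "tame (space M) F D" and m: "\<And>t. F t \<in> borel_measurable M"
    and const: "\<And>t. (\<integral>x. F t x \<partial>M) = (\<integral>x. F 0 x \<partial>M)"
  shows "integrable M D" "(\<integral>x. D x \<partial>M) = 0"
proof -
  from F obtain K where
    K: "\<And>x t. x \<in> space M \<Longrightarrow> \<bar>F t x\<bar> \<le> K" "\<And>x t. x \<in> space M \<Longrightarrow> \<bar>F t x - F 0 x\<bar> \<le> K * \<bar>t\<bar>"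
    unfolding tame_def by metis
  define q where "q k x = (F (1 / Suc k) x - F 0 x) / (1 / Suc k)" for k x
  have int: "integrable M (F t)" for t
    using K(1) m by (intro integrable_const_bound[of _ K]) auto
  have lim: "(\<lambda>k. q k x) \<longlonglongrightarrow> D x" if "x \<in> space M" for x
  proof -
    have "((\<lambda>h. (F (0 + h) x - F 0 x) / h) \<longlongrightarrow> D x) (at 0)"
      using F that by (simp add: tame_def DERIV_def)
    moreover have "filterlim (\<lambda>k. 1 / real (Suc k)) (at 0) sequentially"
      using LIMSEQ_inverse_real_of_nat by (auto simp: filterlim_at inverse_eq_divide)
    ultimately show ?thesis unfolding q_def by (auto dest: filterlim_compose)
  qed
  have bound: "\<bar>q k x\<bar> \<le> K" if "x \<in> space M" for k x
    using K(2)[OF that, of "1 / Suc k"] by (simp add: q_def abs_mult pos_le_divide_eq del: of_nat_Suc)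
  have qm: "q k \<in> borel_measurable M" for k unfolding q_def using m by measurable
  have Dm: "D \<in> borel_measurable M" using lim qm by (rule borel_measurable_LIMSEQ_real)
  have "(\<lambda>k. \<integral>x. q k x \<partial>M) \<longlonglongrightarrow> (\<integral>x. D x \<partial>M)"
    by (rule integral_dominated_convergence[where w="\<lambda>_. K", OF Dm qm]) (use lim bound in auto)
  moreover have "(\<integral>x. q k x \<partial>M) = 0" for k
  proof -
    have "(\<integral>x. q k x \<partial>M) = (\<integral>x. F (1 / Suc k) x - F 0 x \<partial>M) / (1 / Suc k)"
      unfolding q_def by (rule integral_divide_zero)
    also have "(\<integral>x. F (1 / Suc k) x - F 0 x \<partial>M) = (\<integral>x. F (1 / Suc k) x \<partial>M) - (\<integral>x. F 0 x \<partial>M)"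
      by (rule Bochner_Integration.integral_diff[OF int int])
    finally show ?thesis unfolding const[of "1 / Suc k"] by simp
  qed
  ultimately show "(\<integral>x. D x \<partial>M) = 0" by (simp add: LIMSEQ_const_iff)
  show "integrable M D"
    by (rule integrable_dominated_convergence[where w="\<lambda>_. K" and s=q, OF Dm qm]) (use lim bound in auto)
qed

text \<open>A product rule in which \<open>u\<close> need only be continuous, because
  \<open>w\<close> vanishes at 0. In the perturbation formula \<open>u\<close> is an entry of the
  rotated resolvent, whose differentiability is still to be shown.\<close>

lemma DERIV_mult_at_zero:
  fixes u w :: "real \<Rightarrow> real"
  assumes u: "isCont u 0" and w: "(w has_real_derivative w') (at 0)" "w 0 = 0"
  shows "((\<lambda>t. u t * w t) has_real_derivative u 0 * w') (at 0)"
proof -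
  have "((\<lambda>h. u h * (w h / h)) \<longlongrightarrow> u 0 * w') (at 0)"
    using u w by (intro tendsto_mult) (auto simp: isCont_def DERIV_def)
  then show ?thesis using w(2) by (simp add: DERIV_def)
qed

section \<open>Rotation derivatives of the defect and its moment recursion\<close>

context
  fixes n N :: nat and s :: real
begin

private abbreviation "res X \<equiv> resolvent n s X"
private abbreviation "V X \<equiv> resolvent n s X - 1\<^sub>m n"

text \<open>With \<open>n = 2N + 1\<close> and eigenvalues \<open>1\<close> and \<open>exp (\<plusminus>i\<theta>\<^sub>j)\<close> this is
  \<open>\<Sum>\<^sub>j (1 - s\<^sup>2) / \<bar>1 - s exp (i\<theta>\<^sub>j)\<bar>\<^sup>2\<close>.\<close>

definition defect :: "real mat \<Rightarrow> real" where
  "defect X = frob n (resolvent n s X) (1\<^sub>m n) - 1 / (1 - s) - real N"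

context
  assumes n: "n = 2 * N + 1" and s: "0 < s" "s < 1"
begin

text \<open>Everything is read off from \<open>resolvent_givens_entry\<close>: at
  \<open>t = 0\<close> only the \<open>sin t\<close> terms have a nonzero derivative.\<close>

lemma tame_resolvent:
  assumes ij: "i < n" "j < n" "i \<noteq> j" and kl: "k < n" "l < n"
  shows "tame (SO n) (\<lambda>t X. res (givens n i j t * X) $$ (k,l))
    (\<lambda>X. res X $$ (k,i) * V X $$ (j,l) - res X $$ (k,j) * V X $$ (i,l))"
proof -
  define c where "c = real n / (1 - s)"
  \<comment> \<open>\<open>c\<close> bounds the entries of the resolvent and \<open>c + 1\<close>
    those of \<open>V X\<close>. The perturbation formula has four products, each at most
    \<open>c * (c + 1) * \<bar>t\<bar>\<close>.\<close>
  define K where "K = c + 4 * c * (c + 1)"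
  have c0: "c \<ge> 0" using s by (simp add: c_def)
  have GX: "givens n i j t * X \<in> SO n" if "X \<in> SO n" for t X
    using SO_mult[OF givens_SO[OF ij] that] .
  have resc: "res X \<in> carrier_mat n n" if "X \<in> SO n" for X
    using that s by (intro resolvent_carrier) (auto simp: SO_def)
  have bB: "\<bar>res X $$ (a,b)\<bar> \<le> c" if "X \<in> SO n" "a < n" "b < n" for X a b
    using resolvent_entry_bound[OF that(1) s that(2,3)] by (simp add: c_def)
  have bV: "\<bar>V X $$ (a,b)\<bar> \<le> c + 1" if "X \<in> SO n" "a < n" "b < n" for X a b
    using bB[OF that] resc[OF that(1)] that by auto
  have sc: "\<bar>cos t - 1\<bar> \<le> \<bar>t\<bar>" "\<bar>sin t\<bar> \<le> \<bar>t\<bar>" for t :: real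
  proof -
    show "\<bar>sin t\<bar> \<le> \<bar>t\<bar>" by (rule abs_sin_x_le_abs_x)
    have "cos t - 1 = - 2 * (sin (t/2))\<^sup>2"
      using cos_double_sin[of "t/2"] by simp
    then have "\<bar>cos t - 1\<bar> = 2 * (\<bar>sin (t/2)\<bar> * \<bar>sin (t/2)\<bar>)"
      by (simp add: power2_eq_square abs_mult)
    also have "\<dots> \<le> 2 * (\<bar>t/2\<bar> * 1)"
      by (intro mult_left_mono mult_mono abs_sin_x_le_abs_x) auto
    finally show "\<bar>cos t - 1\<bar> \<le> \<bar>t\<bar>" by simp
  qed
  have lip: "\<bar>res (givens n i j t * X) $$ (a,b) - res X $$ (a,b)\<bar> \<le> 4 * c * (c + 1) * \<bar>t\<bar>"
    if X: "X \<in> SO n" and ab: "a < n" "b < n" for X t a b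
  proof -
    have *: "\<bar>x * (p * y + q * z)\<bar> \<le> c * (\<bar>t\<bar> * (c + 1) + \<bar>t\<bar> * (c + 1))"
      if "\<bar>x\<bar> \<le> c" "\<bar>p\<bar> \<le> \<bar>t\<bar>" "\<bar>q\<bar> \<le> \<bar>t\<bar>" "\<bar>y\<bar> \<le> c + 1" "\<bar>z\<bar> \<le> c + 1" for x p q y z
    proof -
      have "\<bar>x * (p * y + q * z)\<bar> \<le> \<bar>x\<bar> * (\<bar>p\<bar> * \<bar>y\<bar> + \<bar>q\<bar> * \<bar>z\<bar>)"
        unfolding abs_mult by (intro mult_left_mono) (metis abs_mult abs_triangle_ineq, simp)
      also have "\<dots> \<le> c * (\<bar>t\<bar> * (c + 1) + \<bar>t\<bar> * (c + 1))"
        using that c0 by (intro mult_mono add_mono) auto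
      finally show ?thesis .
    qed
    have "\<bar>res (givens n i j t * X) $$ (a,b) - res X $$ (a,b)\<bar>
        \<le> \<bar>res (givens n i j t * X) $$ (a,i) * ((cos t - 1) * V X $$ (i,b) + sin t * V X $$ (j,b))\<bar>
         + \<bar>res (givens n i j t * X) $$ (a,j) * ((cos t - 1) * V X $$ (j,b) + (- sin t) * V X $$ (i,b))\<bar>"
      unfolding resolvent_givens_entry[OF X ij s ab] by (rule order_trans[OF abs_triangle_ineq]) simp
    also have "\<dots> \<le> c * (\<bar>t\<bar> * (c + 1) + \<bar>t\<bar> * (c + 1)) + c * (\<bar>t\<bar> * (c + 1) + \<bar>t\<bar> * (c + 1))"
      using X GX ij ab sc by (intro add_mono * bB bV) auto
    finally show ?thesis by (simp add: algebra_simps)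
  qed
  have g0: "res (givens n i j 0 * X) = res X" if "X \<in> SO n" for X
    using that by (auto simp: givens_0 SO_def)
  show ?thesis unfolding tame_def
  proof (intro conjI exI[of _ K] ballI allI)
    fix X t assume X: "X \<in> SO n"
    have c': "0 \<le> 4 * c * (c + 1)" using c0 by simp
    show "\<bar>res (givens n i j t * X) $$ (k,l)\<bar> \<le> K"
      using bB[OF GX[OF X] kl, of t] c' unfolding K_def by linarith
    have "4 * c * (c + 1) * \<bar>t\<bar> \<le> K * \<bar>t\<bar>"
      by (rule mult_right_mono) (use c0 in \<open>auto simp: K_def\<close>)
    then show "\<bar>res (givens n i j t * X) $$ (k,l) - res (givens n i j 0 * X) $$ (k,l)\<bar> \<le> K * \<bar>t\<bar>"
      using lip[OF X kl, of t] by (simp add: g0[OF X])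
    have cont: "isCont (\<lambda>t. res (givens n i j t * X) $$ (a,b)) 0" if "a < n" "b < n" for a b
    proof -
      have "((\<lambda>t. res (givens n i j t * X) $$ (a,b) - res X $$ (a,b)) \<longlongrightarrow> 0) (at 0)"
      proof (rule Lim_null_comparison)
        show "\<forall>\<^sub>F t in at 0. norm (res (givens n i j t * X) $$ (a,b) - res X $$ (a,b)) \<le> 4 * c * (c + 1) * \<bar>t\<bar>"
          using lip[OF X that] by simp
        show "((\<lambda>t. 4 * c * (c + 1) * \<bar>t\<bar>) \<longlongrightarrow> 0) (at 0)"
          by (auto intro!: tendsto_eq_intros)
      qed
      then show ?thesis by (simp add: isCont_def LIM_zero_iff g0[OF X])
    qed
    \<comment> \<open>The entry is rewritten as its value at 0 plus the perturbation terms, which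
      have the form treated by \<open>DERIV_mult_at_zero\<close>.\<close>
    let ?b = "res X $$ (k,l)"
    have "((\<lambda>t. ?b + (res (givens n i j t * X) $$ (k,i) * ((cos t - 1) * V X $$ (i,l) + sin t * V X $$ (j,l))
       + res (givens n i j t * X) $$ (k,j) * ((cos t - 1) * V X $$ (j,l) - sin t * V X $$ (i,l))))
       has_real_derivative 0 + (res (givens n i j 0 * X) $$ (k,i) * V X $$ (j,l) + res (givens n i j 0 * X) $$ (k,j) * (- V X $$ (i,l)))) (at 0)"
      using ij kl by (intro DERIV_add DERIV_mult_at_zero cont DERIV_const) (auto intro!: derivative_eq_intros)
    moreover have "?b + (res (givens n i j t * X) $$ (k,i) * ((cos t - 1) * V X $$ (i,l) + sin t * V X $$ (j,l))
       + res (givens n i j t * X) $$ (k,j) * ((cos t - 1) * V X $$ (j,l) - sin t * V X $$ (i,l))) = res (givens n i j t * X) $$ (k,l)" for t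
      using resolvent_givens_entry[OF X ij s kl, of t] by linarith
    ultimately show "((\<lambda>t. res (givens n i j t * X) $$ (k,l)) has_real_derivative
        res X $$ (k,i) * V X $$ (j,l) - res X $$ (k,j) * V X $$ (i,l)) (at 0)"
      by (simp add: g0[OF X])
  qed
qed

text \<open>The defect is a trace up to constants, and summing the entry derivatives over the
  diagonal recombines them into entries of \<open>V X * res X\<close>.\<close>

lemma tame_defect:
  assumes ij: "i < n" "j < n" "i \<noteq> j"
  shows "tame (SO n) (\<lambda>t X. defect (givens n i j t * X))
    (\<lambda>X. (V X * res X) $$ (j,i) - (V X * res X) $$ (i,j))"
proof -
  have "tame (SO n) (\<lambda>t X. (\<Sum>k<n. res (givens n i j t * X) $$ (k,k)) - (1 / (1 - s) + real N))
    (\<lambda>X. (\<Sum>k<n. res X $$ (k,i) * V X $$ (j,k) - res X $$ (k,j) * V X $$ (i,k)) - 0)"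
    using ij by (intro tame_diff tame_sum tame_resolvent tame_const) auto
  moreover have "(\<Sum>k<n. res X $$ (k,i) * V X $$ (j,k) - res X $$ (k,j) * V X $$ (i,k)) - 0
     = (V X * res X) $$ (j,i) - (V X * res X) $$ (i,j)" if "X \<in> SO n" for X
  proof -
    have B: "res X \<in> carrier_mat n n"
      using that s by (intro resolvent_carrier) (auto simp: SO_def)
    have Vc: "V X \<in> carrier_mat n n" by (simp add: minus_carrier_mat)
    show ?thesis using ij
      by (simp only: index_mult[OF Vc B ij(2,1)] index_mult[OF Vc B ij(1,2)]) (simp add: sum_subtractf mult.commute)
  qed
  ultimately show ?thesis
    by (simp add: tame_def defect_def frob_one diff_diff_eq)
qed

lemma resolvent_measurable_haar:
  assumes "haar_prob_SO n \<mu>"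
  shows "i < n \<Longrightarrow> j < n \<Longrightarrow> (\<lambda>X. res X $$ (i,j)) \<in> borel_measurable \<mu>" 
    and "defect \<in> borel_measurable \<mu>"
proof -
  have sets: "sets \<mu> = sets (borel_SO n)" using assms by (simp add: haar_prob_SO_def)
  show 1: "(\<lambda>X. res X $$ (i,j)) \<in> borel_measurable \<mu>" if "i < n" "j < n" for i j
    using measurable_resolvent[OF that, of s] by (simp add: measurable_cong_sets[OF sets refl])
  show "defect \<in> borel_measurable \<mu>"
    unfolding defect_def[abs_def] frob_one
    by (intro borel_measurable_diff borel_measurable_sum borel_measurable_const 1) auto
qed

lemma defect_bounds:
  assumes X: "X \<in> SO n"
  shows "0 \<le> defect X" "\<bar>defect X\<bar> \<le> (real n)\<^sup>2 / (1 - s) + 1 / (1 - s) + real N"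
proof -
  show 0: "0 \<le> defect X"
    using resolvent_defect(1)[OF X s n] by (simp add: defect_def)
  have le: "(\<Sum>i<n. res X $$ (i,i)) \<le> (\<Sum>i<n. real n / (1 - s))"
    using resolvent_entry_bound[OF X s] by (intro sum_mono) (auto dest: abs_le_D1)
  show "\<bar>defect X\<bar> \<le> (real n)\<^sup>2 / (1 - s) + 1 / (1 - s) + real N"
  proof -
    have "0 \<le> 1 / (1 - s)" using s by simp
    moreover have "(\<Sum>i<n. real n / (1 - s)) = (real n)\<^sup>2 / (1 - s)" by (simp add: power2_eq_square)
    ultimately show ?thesis
      using le unfolding abs_of_nonneg[OF 0] unfolding defect_def frob_one by linarith
  qed
qed

lemma integrable_defect_power:
  assumes "haar_prob_SO n \<mu>"
  shows "integrable \<mu> (\<lambda>X. defect X ^ p)"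
proof -
  interpret prob_space \<mu> using assms by (simp add: haar_prob_SO_def)
  have sp: "space \<mu> = SO n" using assms by (simp add: haar_prob_SO_def)
  note resolvent_measurable_haar(2)[OF assms, measurable]
  show ?thesis
    using defect_bounds sp
    by (intro integrable_const_bound[of _ "((real n)\<^sup>2 / (1 - s) + 1 / (1 - s) + real N) ^ p"])
       (auto simp: power_abs intro!: power_mono)
qed

text \<open>The derivatives at \<open>t = 0\<close> of the invariant integrals of
  \<open>(B $$ (j,i) - B $$ (i,j)) * defect ^ p\<close>, with \<open>B\<close> the resolvent of \<open>givens n i j t * X\<close>, summed over all \<open>i\<close> and \<open>j\<close>.\<close>

lemma loop_equation:
  fixes p :: nat
  assumes haar: "haar_prob_SO n \<mu>"
  defines "W \<equiv> \<lambda>X. frob n (res X - transpose_mat (res X)) (V X * res X - transpose_mat (V X * res X))"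
  defines "L \<equiv> \<lambda>X. 2 * defect X ^ p * (frob n (res X) (res X) - frob n (res X) (1\<^sub>m n)
      - frob n (res X) (1\<^sub>m n) * (frob n (res X) (1\<^sub>m n) - real n)) + real p * defect X ^ (p - 1) * W X"
  shows "integrable \<mu> L" "(\<integral>X. L X \<partial>\<mu>) = 0"
proof -
  interpret prob_space \<mu> using haar by (simp add: haar_prob_SO_def)
  have sp: "space \<mu> = SO n" and sets: "sets \<mu> = sets (borel_SO n)" using haar by (auto simp: haar_prob_SO_def)
  define E where "E i j X = ((res X $$ (j,i) * V X $$ (j,i) - res X $$ (j,j) * V X $$ (i,i)) -
      (res X $$ (i,i) * V X $$ (j,j) - res X $$ (i,j) * V X $$ (i,j))) * defect X ^ p
      + (res X $$ (j,i) - res X $$ (i,j)) * (real p * defect X ^ (p - 1) * ((V X * res X) $$ (j,i) - (V X * res X) $$ (i,j)))" for i j X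
  have resc: "res X \<in> carrier_mat n n" if "X \<in> SO n" for X
    using that s by (intro resolvent_carrier) (auto simp: SO_def)
  note meas = resolvent_measurable_haar[OF haar]
  have E: "integrable \<mu> (E i j)" "(\<integral>X. E i j X \<partial>\<mu>) = 0" if ij: "i < n" "j < n" "i \<noteq> j" for i j
  proof -
    define F where "F t X = (res (givens n i j t * X) $$ (j,i) - res (givens n i j t * X) $$ (i,j)) * defect (givens n i j t * X) ^ p" for t X
    have g0: "givens n i j 0 * X = X" if "X \<in> SO n" for X using that by (auto simp: givens_0 SO_def)
    have "tame (SO n) F (\<lambda>X. ((res X $$ (j,i) * V X $$ (j,i) - res X $$ (j,j) * V X $$ (i,i)) -
      (res X $$ (i,i) * V X $$ (j,j) - res X $$ (i,j) * V X $$ (i,j))) * defect (givens n i j 0 * X) ^ p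
      + (res (givens n i j 0 * X) $$ (j,i) - res (givens n i j 0 * X) $$ (i,j)) *
        (real p * defect (givens n i j 0 * X) ^ (p - 1) * ((V X * res X) $$ (j,i) - (V X * res X) $$ (i,j))))"
      unfolding F_def using ij
      by (intro tame_mult[where F'="\<lambda>t X. defect (givens n i j t * X) ^ p"] tame_diff tame_resolvent tame_power[where F="\<lambda>t X. defect (givens n i j t * X)"] tame_defect)
    then have "tame (SO n) F (E i j)"
      unfolding tame_def by (simp add: g0 E_def)
    then have tame: "tame (space \<mu>) F (E i j)" by (simp add: sp)
    define f where "f X = (res X $$ (j,i) - res X $$ (i,j)) * defect X ^ p" for X
    have f: "f \<in> borel_measurable \<mu>"
      unfolding f_def[abs_def] using ij by (intro borel_measurable_times borel_measurable_diff borel_measurable_power meas) auto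
    have Ff: "F t X = f (givens n i j t * X)" for t X by (simp add: F_def f_def)
    have Gm: "(\<lambda>X. givens n i j t * X) \<in> measurable \<mu> \<mu>" for t
      using measurable_SO_mult[OF givens_SO[OF ij]] by (simp add: measurable_cong_sets[OF sets sets])
    have Fm: "F t \<in> borel_measurable \<mu>" for t
      unfolding Ff[abs_def] using measurable_compose[OF Gm f] .
    have "(\<integral>X. F t X \<partial>\<mu>) = (\<integral>X. f X \<partial>\<mu>)" for t
      unfolding Ff by (rule haar_integral_mult[OF haar givens_SO[OF ij] f])
    then have const: "(\<integral>X. F t X \<partial>\<mu>) = (\<integral>X. F 0 X \<partial>\<mu>)" for t by simp
    show "integrable \<mu> (E i j)" "(\<integral>X. E i j X \<partial>\<mu>) = 0"
      using integral_tame_derivative[OF tame Fm const] by auto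
  qed
  \<comment> \<open>The diagonal terms vanish identically, so the sum may run over all pairs
    although a rotation requires distinct indices.\<close>
  have Eii: "E i i = (\<lambda>X. 0)" for i by (auto simp: E_def)
  have E': "integrable \<mu> (E i j)" "(\<integral>X. E i j X \<partial>\<mu>) = 0" if "i < n" "j < n" for i j
    using E[OF that] by (cases "i = j"; simp add: Eii)+
  have L: "L X = (\<Sum>i<n. \<Sum>j<n. E i j X)" if X: "X \<in> space \<mu>" for X
  proof -
    have B: "res X \<in> carrier_mat n n" using X resc sp by auto
    have Vc: "V X \<in> carrier_mat n n" by (simp add: minus_carrier_mat)
    have Z: "V X * res X \<in> carrier_mat n n" using Vc B by simp
    let ?b = "\<lambda>i j. res X $$ (i,j)" and ?v = "\<lambda>i j. V X $$ (i,j)" and ?z = "\<lambda>i j. (V X * res X) $$ (i,j)"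
    have BV: "frob n (res X) (V X) = frob n (res X) (res X) - frob n (res X) (1\<^sub>m n)"
      using B by (simp add: frob_diff_right)
    have trV: "(\<Sum>i<n. ?v i i) = frob n (res X) (1\<^sub>m n) - real n"
      using frob_diff[OF B one_carrier_mat, of "1\<^sub>m n"] unfolding frob_one_one by (simp only: frob_one)
    have WX: "W X = (\<Sum>i<n. \<Sum>j<n. (?b i j - ?b j i) * (?z i j - ?z j i))"
      unfolding W_def frob_def using B Z by (intro sum.cong refl) (simp del: index_mult_mat(1))
    have tt: "(\<Sum>i<n. \<Sum>j<n. ?b j j * ?v i i) = frob n (res X) (1\<^sub>m n) * (frob n (res X) (1\<^sub>m n) - real n)"
      "(\<Sum>i<n. \<Sum>j<n. ?b i i * ?v j j) = frob n (res X) (1\<^sub>m n) * (frob n (res X) (1\<^sub>m n) - real n)"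
      unfolding trV[symmetric] unfolding frob_one by (simp_all only: sum_distrib_left[symmetric] sum_distrib_right[symmetric])
    have bv: "(\<Sum>i<n. \<Sum>j<n. ?b j i * ?v j i) = frob n (res X) (V X)" "(\<Sum>i<n. \<Sum>j<n. ?b i j * ?v i j) = frob n (res X) (V X)"
      unfolding frob_def by (rule sum.swap, rule refl)
    have pull: "(\<Sum>i<n. \<Sum>j<n. c * g i j) = c * (\<Sum>i<n. \<Sum>j<n. g i j)" for c :: real and g
      by (simp add: sum_distrib_left)
    \<comment> \<open>The first bracket contributes twice the Frobenius product of
      \<open>res X\<close> and \<open>V X\<close> minus twice the product of their traces. In the
      last term the sign changes of both antisymmetric differences cancel, which leaves
      \<open>W X\<close>.\<close>
    have "(\<Sum>i<n. \<Sum>j<n. E i j X) = (\<Sum>i<n. \<Sum>j<n. defect X ^ p * (?b j i * ?v j i)) - (\<Sum>i<n. \<Sum>j<n. defect X ^ p * (?b j j * ?v i i))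
       - (\<Sum>i<n. \<Sum>j<n. defect X ^ p * (?b i i * ?v j j)) + (\<Sum>i<n. \<Sum>j<n. defect X ^ p * (?b i j * ?v i j))
       + (\<Sum>i<n. \<Sum>j<n. real p * defect X ^ (p - 1) * ((?b i j - ?b j i) * (?z i j - ?z j i)))"
      unfolding sum.distrib[symmetric] sum_subtractf[symmetric] E_def
      by (intro sum.cong refl) (simp add: algebra_simps del: index_mult_mat(1) index_minus_mat(1))
    also have "\<dots> = L X"
      unfolding pull tt bv WX[symmetric] BV L_def by (simp add: algebra_simps)
    finally show ?thesis ..
  qed
  have I: "integrable \<mu> (\<lambda>X. \<Sum>i<n. \<Sum>j<n. E i j X)"
    using E' by (intro Bochner_Integration.integrable_sum) auto
  show "integrable \<mu> L" using I by (subst Bochner_Integration.integrable_cong[OF refl L])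
  have "(\<integral>X. L X \<partial>\<mu>) = (\<integral>X. (\<Sum>i<n. \<Sum>j<n. E i j X) \<partial>\<mu>)"
    using L by (intro Bochner_Integration.integral_cong) auto
  also have "\<dots> = (\<Sum>i<n. (\<integral>X. (\<Sum>j<n. E i j X) \<partial>\<mu>))"
    using E'(1) by (intro Bochner_Integration.integral_sum Bochner_Integration.integrable_sum) auto
  also have "\<dots> = (\<Sum>i<n. \<Sum>j<n. (\<integral>X. E i j X \<partial>\<mu>))"
    using E'(1) by (intro sum.cong refl Bochner_Integration.integral_sum) auto
  also have "\<dots> = 0" using E' by simp
  finally show "(\<integral>X. L X \<partial>\<mu>) = 0" .
qed

text \<open>Trace and norm of the resolvent are affine in the defect, so the loop equation relates
  consecutive moments. The bound of \<open>resolvent_defect\<close> on \<open>W\<close> absorbs the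
  remaining term into the moment of order \<open>p\<close>, at the price of an inequality.\<close>

lemma defect_moment_recursion:
  assumes haar: "haar_prob_SO n \<mu>"
  shows "(\<integral>X. defect X ^ (p + 2) \<partial>\<mu>) + 2 * s / (1 - s\<^sup>2) * (\<integral>X. defect X ^ (p + 1) \<partial>\<mu>)
    \<le> ((real N)\<^sup>2 + 4 * real p / (1 - s)\<^sup>2) * (\<integral>X. defect X ^ p \<partial>\<mu>)"
proof -
  interpret prob_space \<mu> using haar by (simp add: haar_prob_SO_def)
  have sp: "space \<mu> = SO n" using haar by (auto simp: haar_prob_SO_def)
  define c where "c = 2 * s / (1 - s\<^sup>2)"
  have s1: "1 - s \<noteq> 0" "1 - s\<^sup>2 > 0" using s by (auto simp: power2_eq_1_iff power_less_one_iff abs_square_less_1)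
  define W where "W = (\<lambda>X. frob n (res X - transpose_mat (res X)) (V X * res X - transpose_mat (V X * res X)))"
  define L where "L = (\<lambda>X. 2 * defect X ^ p * (frob n (res X) (res X) - frob n (res X) (1\<^sub>m n)
      - frob n (res X) (1\<^sub>m n) * (frob n (res X) (1\<^sub>m n) - real n)) + real p * defect X ^ (p - 1) * W X)"
  have L: "integrable \<mu> L" "(\<integral>X. L X \<partial>\<mu>) = 0"
    using loop_equation[OF haar, of p] unfolding L_def W_def by auto
  define R where "R X = 2 * ((real N)\<^sup>2 + 4 * real p / (1 - s)\<^sup>2) * defect X ^ p - 2 * defect X ^ (p + 2) - 2 * c * defect X ^ (p + 1)" for X
  note int = integrable_defect_power[OF haar]
  have R: "integrable \<mu> R" unfolding R_def[abs_def]
    by (intro Bochner_Integration.integrable_diff integrable_mult_right int)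
  have LR: "L X \<le> R X" if "X \<in> space \<mu>" for X
  proof -
    have X: "X \<in> SO n" using that sp by simp
    let ?\<tau> = "defect X" and ?b = "frob n (res X) (1\<^sub>m n)" and ?f = "frob n (res X) (res X)"
    have b: "?b = 1 / (1 - s) + real N + ?\<tau>" by (simp add: defect_def)
    have f: "(1 - s\<^sup>2) * ?f = 2 * ?b - real n" by (rule resolvent_frob[OF X s])
    \<comment> \<open>With \<open>n = 2 N + 1\<close> and \<open>?b = r + N + ?\<tau>\<close> the
      trace terms give \<open>N^2 - (r + ?\<tau>)^2\<close>. Its \<open>r^2\<close> cancels against
      the one in \<open>?f = r^2 + 2 ?\<tau> q\<close>, and \<open>c = 2 (r - q)\<close>.\<close>
    have "?f - ?b - ?b * (?b - real n) = (real N)\<^sup>2 - ?\<tau>\<^sup>2 - c * ?\<tau>"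
    proof -
      define r where "r = 1 / (1 - s)"
      have sr: "s = 1 - 1 / r" "r \<noteq> 0" using s1 by (auto simp: r_def)
      define q where "q = 1 / (1 - s\<^sup>2)"
      have q: "(1 - s\<^sup>2) * q = 1" using s1 by (simp add: q_def)
      have fq: "?f = (2 * ?b - real n) * q" using f q by (metis mult.assoc mult.commute mult.right_neutral)
      have rq: "r = (1 + s) * q"
        using s s1 unfolding r_def q_def by (simp add: power2_eq_square field_simps)
      have "?f = ((1 + s) * r + 2 * ?\<tau>) * q"
      proof -
        have "2 * r - 1 = (1 + s) * r" using s1 by (simp add: r_def field_simps)
        then show ?thesis unfolding fq using b n by (simp add: r_def)
      qed
      also have "\<dots> = r\<^sup>2 + 2 * ?\<tau> * q"
        unfolding power2_eq_square by (subst (3) rq) (simp add: algebra_simps)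
      finally have f': "?f = r\<^sup>2 + 2 * ?\<tau> * q" .
      have b': "?b = r + real N + ?\<tau>" using b by (simp add: r_def)
      have c': "c = 2 * r - 2 * q" unfolding rq c_def by (simp add: q_def algebra_simps add_divide_distrib)
      show ?thesis unfolding f' b' c' using n by (simp add: power2_eq_square algebra_simps)
    qed
    then have "L X = 2 * ?\<tau> ^ p * ((real N)\<^sup>2 - ?\<tau>\<^sup>2 - c * ?\<tau>) + real p * ?\<tau> ^ (p - 1) * W X"
      by (simp add: L_def)
    also have "real p * ?\<tau> ^ (p - 1) * W X \<le> real p * ?\<tau> ^ (p - 1) * (8 * ?\<tau> / (1 - s)\<^sup>2)"
      using resolvent_defect(2)[OF X s n] defect_bounds(1)[OF X]
      by (intro mult_left_mono) (auto simp: W_def defect_def)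
    \<comment> \<open>For \<open>p = 0\<close> both sides vanish; otherwise the factor
      \<open>?\<tau>\<close> restores the exponent \<open>p\<close>.\<close>
    also have "\<dots> = 8 * real p / (1 - s)\<^sup>2 * ?\<tau> ^ p"
      by (cases p) auto
    finally show ?thesis by (simp add: R_def algebra_simps power2_eq_square)
  qed
  have "0 \<le> (\<integral>X. R X \<partial>\<mu>)" using integral_mono[OF L(1) R LR] L(2) by simp
  also have "\<dots> = 2 * ((real N)\<^sup>2 + 4 * real p / (1 - s)\<^sup>2) * (\<integral>X. defect X ^ p \<partial>\<mu>)
      - 2 * (\<integral>X. defect X ^ (p + 2) \<partial>\<mu>) - 2 * c * (\<integral>X. defect X ^ (p + 1) \<partial>\<mu>)"
    unfolding R_def[abs_def] using int[of p] int[of "p+1"] int[of "p+2"]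
    by (simp del: power_Suc add_2_eq_Suc' add_Suc_right)
  finally have fin: "0 \<le> \<dots>" .
  have "y + c * z \<le> A * x" if "0 \<le> 2 * A * x - 2 * y - 2 * c * z" for A x y z :: real
    using that by (simp add: algebra_simps)
  from this[OF fin] show ?thesis unfolding c_def .
qed

end

end

subsection \<open>Moments\<close>

text \<open>Induction in steps of two. The zeroth moment is 1 and carries no small factor, so orders
  1 and 2 are both base cases, read off from the two terms on the left of the recursion at
  \<open>p = 0\<close>. From order 3 on, the moment two orders below supplies the factor
  \<open>((1 - s) * real N)^2\<close>.\<close>

lemma scaled_defect_moments:
  assumes "m \<ge> 1"
  shows "\<exists>C>0. \<forall>N s \<mu>. 1/2 \<le> s \<longrightarrow> s < 1 \<longrightarrow> ((1 - s) * real N)\<^sup>2 \<le> 1 \<longrightarrow> haar_prob_SO (2 * N + 1) \<mu> \<longrightarrow>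
    (\<integral>X. ((1 - s) * defect (2 * N + 1) N s X) ^ m \<partial>\<mu>) \<le> C * ((1 - s) * real N)\<^sup>2"
  using assms
proof (induction m rule: less_induct)
  case (less m)
  define I where "I N s \<mu> p = (\<integral>X. defect (2 * N + 1) N s X ^ p \<partial>\<mu>)" for N s \<mu> p
  have eqI: "(\<integral>X. ((1 - s) * defect (2 * N + 1) N s X) ^ m \<partial>\<mu>) = (1 - s) ^ m * I N s \<mu> m" for N s \<mu> m
    by (simp add: I_def power_mult_distrib)
  have rec: "I N s \<mu> (p + 2) + 2 * s / (1 - s\<^sup>2) * I N s \<mu> (p + 1) \<le> ((real N)\<^sup>2 + 4 * real p / (1 - s)\<^sup>2) * I N s \<mu> p"
    if "1/2 \<le> s" "s < 1" "haar_prob_SO (2 * N + 1) \<mu>" for N s \<mu> p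
    unfolding I_def using that by (intro defect_moment_recursion) auto
  have I0: "I N s \<mu> 0 = 1" if "haar_prob_SO (2 * N + 1) \<mu>" for N s \<mu>
    using that prob_space.prob_space[of \<mu>] by (simp add: I_def haar_prob_SO_def)
  have Inn: "0 \<le> I N s \<mu> p" if "1/2 \<le> s" "s < 1" "haar_prob_SO (2 * N + 1) \<mu>" for N s \<mu> p
    unfolding I_def using that
    by (intro Bochner_Integration.integral_nonneg zero_le_power defect_bounds(1)) (auto simp: haar_prob_SO_def)
  have s2: "0 < 1 - s\<^sup>2" "0 \<le> 2 * s / (1 - s\<^sup>2)" if "1/2 \<le> s" "s < 1" for s :: real
  proof -
    show "0 < 1 - s\<^sup>2" using that by (simp add: power_less_one_iff abs_square_less_1)
    then show "0 \<le> 2 * s / (1 - s\<^sup>2)" using that by simp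
  qed
  consider "m = 1" | "m = 2" | p where "p \<ge> 1" "m = p + 2"
    using less.prems by (metis One_nat_def Suc_1 add_2_eq_Suc' le_SucE le_Suc_ex not_less_eq_eq plus_1_eq_Suc add.commute)
  then show ?case
  proof cases
    case 1
    \<comment> \<open>Dropping the second moment leaves the linear term. The constant 2 comes from
      \<open>2 * s \<ge> 1\<close> and \<open>1 - s^2 \<le> 2 * (1 - s)\<close>.\<close>
    have "(1 - s) ^ m * I N s \<mu> m \<le> 2 * ((1 - s) * real N)\<^sup>2"
      if s: "1/2 \<le> s" "s < 1" and h: "haar_prob_SO (2 * N + 1) \<mu>" for N s \<mu>
    proof -
      have "2 * s / (1 - s\<^sup>2) * I N s \<mu> 1 \<le> (real N)\<^sup>2"
        using rec[OF s h, of 0] I0[OF h] Inn[OF s h, of 2] by (simp add: numeral_2_eq_2)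
      then have "2 * s * I N s \<mu> 1 \<le> (real N)\<^sup>2 * (1 - s\<^sup>2)"
        using s2[OF s] by (simp add: field_simps)
      moreover have "1 * I N s \<mu> 1 \<le> 2 * s * I N s \<mu> 1"
        using s Inn[OF s h] by (intro mult_right_mono) auto
      moreover have "(real N)\<^sup>2 * (1 - s\<^sup>2) \<le> (real N)\<^sup>2 * (2 * (1 - s))"
      proof (rule mult_left_mono)
        have "1 - s\<^sup>2 = (1 + s) * (1 - s)" by (simp add: power2_eq_square algebra_simps)
        also have "\<dots> \<le> 2 * (1 - s)" using s by (intro mult_right_mono) auto
        finally show "1 - s\<^sup>2 \<le> 2 * (1 - s)" .
      qed simp
      ultimately have "I N s \<mu> 1 \<le> (real N)\<^sup>2 * (2 * (1 - s))" by linarith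
      then have "(1 - s) * I N s \<mu> 1 \<le> (1 - s) * ((real N)\<^sup>2 * (2 * (1 - s)))"
        using s by (intro mult_left_mono) auto
      then show ?thesis using 1 by (simp add: power2_eq_square algebra_simps)
    qed
    then show ?thesis unfolding eqI by (intro exI[of _ 2]) auto
  next
    case 2
    have "(1 - s) ^ m * I N s \<mu> m \<le> 1 * ((1 - s) * real N)\<^sup>2"
      if s: "1/2 \<le> s" "s < 1" and h: "haar_prob_SO (2 * N + 1) \<mu>" for N s \<mu>
    proof -
      have "0 \<le> 2 * s / (1 - s\<^sup>2) * I N s \<mu> 1"
        using s2[OF s] Inn[OF s h] by (intro mult_nonneg_nonneg) auto
      then have "I N s \<mu> 2 \<le> (real N)\<^sup>2"
        using rec[OF s h, of 0] I0[OF h] by (simp add: numeral_2_eq_2)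
      then show ?thesis using 2 by (simp add: power_mult_distrib mult_left_mono)
    qed
    then show ?thesis unfolding eqI by (intro exI[of _ 1]) auto
  next
    case (3 p)
    obtain C where C: "C > 0" "\<And>N s \<mu>. 1/2 \<le> s \<Longrightarrow> s < 1 \<Longrightarrow> ((1 - s) * real N)\<^sup>2 \<le> 1 \<Longrightarrow> haar_prob_SO (2 * N + 1) \<mu> \<Longrightarrow>
       (1 - s) ^ p * I N s \<mu> p \<le> C * ((1 - s) * real N)\<^sup>2"
      using less.IH[of p] 3 unfolding eqI by auto
    \<comment> \<open>Two of the \<open>m\<close> factors \<open>1 - s\<close> rescale the
      coefficient of the recursion to \<open>((1 - s) * real N)^2 + 4 * real p\<close>, at most
      \<open>1 + 4 * real p\<close>; the other \<open>p\<close> belong to the induction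
      hypothesis.\<close>
    have "(1 - s) ^ m * I N s \<mu> m \<le> ((1 + 4 * real p) * C) * ((1 - s) * real N)\<^sup>2"
      if s: "1/2 \<le> s" "s < 1" and d: "((1 - s) * real N)\<^sup>2 \<le> 1" and h: "haar_prob_SO (2 * N + 1) \<mu>" for N s \<mu>
    proof -
      have "0 \<le> 2 * s / (1 - s\<^sup>2) * I N s \<mu> (p + 1)"
        using s2[OF s] Inn[OF s h] by (intro mult_nonneg_nonneg) auto
      then have "I N s \<mu> m \<le> ((real N)\<^sup>2 + 4 * real p / (1 - s)\<^sup>2) * I N s \<mu> p"
        using rec[OF s h, of p] 3 by simp
      then have "(1 - s) ^ m * I N s \<mu> m \<le> (1 - s) ^ m * (((real N)\<^sup>2 + 4 * real p / (1 - s)\<^sup>2) * I N s \<mu> p)"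
        using s by (intro mult_left_mono) auto
      also have "\<dots> = ((1 - s)\<^sup>2 * ((real N)\<^sup>2 + 4 * real p / (1 - s)\<^sup>2)) * ((1 - s) ^ p * I N s \<mu> p)"
        unfolding 3(2) power_add by (simp only: ac_simps)
      also have "(1 - s)\<^sup>2 * ((real N)\<^sup>2 + 4 * real p / (1 - s)\<^sup>2) = ((1 - s) * real N)\<^sup>2 + 4 * real p"
        using s by (simp add: distrib_left power_mult_distrib)
      also have "(((1 - s) * real N)\<^sup>2 + 4 * real p) * ((1 - s) ^ p * I N s \<mu> p) \<le> (1 + 4 * real p) * (C * ((1 - s) * real N)\<^sup>2)"
        by (rule mult_mono) (use d C(2)[OF s d h] s Inn[OF s h] in auto)
      finally show ?thesis by (simp only: mult.assoc)
    qed
    moreover have "(1 + 4 * real p) * C > 0" using C(1) by (intro mult_pos_pos) auto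
    ultimately show ?thesis unfolding eqI by blast
  qed
qed

section \<open>Elementary estimates for the exponential and for real powers\<close>

lemma exp_neg_estimates:
  fixes \<alpha> :: real
  assumes \<alpha>: "0 < \<alpha>" "\<alpha> \<le> 1/2"
  defines "s \<equiv> exp (- \<alpha>)"
  shows "1/2 \<le> s" "s < 1" "1 - s \<le> \<alpha>" "1 \<le> \<alpha> / (1 - s)" "\<alpha> / (1 - s) \<le> 1 + \<alpha>" "1 \<le> 1 / s" "1 / s \<le> 1 + 2 * \<alpha>"
proof -
  show s1: "s < 1" using \<alpha> by (simp add: s_def)
  have s0: "s > 0" by (simp add: s_def)
  have ge: "1 - \<alpha> \<le> s" unfolding s_def using exp_ge_add_one_self[of "- \<alpha>"] by simp
  then show "1/2 \<le> s" "1 - s \<le> \<alpha>" using \<alpha> by auto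
  then show "1 \<le> \<alpha> / (1 - s)" using s1 by simp
  \<comment> \<open>After clearing denominators the bound on \<open>\<alpha> / (1 - s)\<close>
    becomes \<open>(1 + \<alpha>) * s \<le> 1\<close>.\<close>
  have "(1 + \<alpha>) * s \<le> exp \<alpha> * s" using s0 by (intro mult_right_mono) auto
  also have "\<dots> = 1" by (simp add: s_def exp_minus)
  finally show "\<alpha> / (1 - s) \<le> 1 + \<alpha>" using s1 by (simp add: field_simps)
  show "1 \<le> 1 / s" using s0 s1 by simp
  have "1 \<le> (1 + 2 * \<alpha>) * (1 - \<alpha>)" using mult_left_mono[OF \<alpha>(2), of \<alpha>] \<alpha> by (simp add: algebra_simps)
  also have "\<dots> \<le> (1 + 2 * \<alpha>) * s" using ge \<alpha> by (intro mult_left_mono) auto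
  finally show "1 / s \<le> 1 + 2 * \<alpha>" using s0 by (simp add: field_simps)
qed

lemma log_deriv_char_fun_defect:
  assumes X: "X \<in> SO (2 * N + 1)" and s: "0 < s" "s < 1"
  shows "- \<alpha> * log_deriv (char_fun X) s
    = (\<alpha> / (1 - s) - \<alpha> * real N / s) + \<alpha> / s * defect (2 * N + 1) N s X"
proof -
  have b: "frob (2 * N + 1) (resolvent (2 * N + 1) s X) (1\<^sub>m (2 * N + 1))
      = 1 / (1 - s) + real N + defect (2 * N + 1) N s X"
    by (subst defect_def) simp
  have "- \<alpha> * (- (r + real N + t - real (2 * N + 1)) / s) = \<alpha> / s * (r - real N - 1 + t)" for r t
    using s by (simp add: field_simps)
  then have "- \<alpha> * log_deriv (char_fun X) s = \<alpha> / s * (1 / (1 - s) - real N - 1 + defect (2 * N + 1) N s X)"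
    unfolding log_deriv_char_fun[OF X s] b by blast
  \<comment> \<open>One unit of \<open>n = 2 N + 1\<close> goes to the eigenvalue 1, whose
    contribution \<open>s / (1 - s)\<close> cancels the \<open>s\<close> in the prefactor.\<close>
  also have "1 / (1 - s) - real N - 1 = s / (1 - s) - real N" using s by (simp add: field_simps)
  also have "\<alpha> / s * (s / q - real N + t) = (\<alpha> / q - \<alpha> * real N / s) + \<alpha> / s * t" for q t
    using s by (cases "q = 0") (simp_all add: field_simps)
  finally show ?thesis .
qed

text \<open>A power is monotone in its base, so the endpoints bound it for either sign of
  \<open>L\<close>. The interval contains \<open>1 - x\<close> for
  \<open>\<bar>x\<bar> \<le> 1/2\<close> and \<open>b + r\<close> for
  \<open>1/2 \<le> b \<le> 2\<close> and \<open>0 \<le> r \<le> 1\<close>.\<close>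

lemma powr_bounded_on_interval:
  obtains M :: real where "M > 0" "\<And>u. 1/2 \<le> u \<Longrightarrow> u \<le> 3 \<Longrightarrow> u powr L \<le> M"
proof
  show "(0::real) < 3 powr L + (1/2) powr L" by (simp add: add_pos_pos)
  fix u :: real assume u: "1/2 \<le> u" "u \<le> 3"
  show "u powr L \<le> 3 powr L + (1/2) powr L"
  proof (cases "L \<ge> 0")
    case True
    then have "u powr L \<le> 3 powr L" using u by (intro powr_mono2) auto
    moreover have "0 \<le> (1/2::real) powr L" by simp
    ultimately show ?thesis by linarith
  next
    case False
    then have "u powr L \<le> (1/2) powr L" using u by (intro powr_mono2') auto
    moreover have "0 \<le> (3::real) powr L" by simp
    ultimately show ?thesis by linarith
  qed
qed

lemma powr_lipschitz:
  fixes L :: real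
  obtains M where "M > 0" "\<And>u v. u \<in> {1/2..3} \<Longrightarrow> v \<in> {1/2..3} \<Longrightarrow> \<bar>u powr L - v powr L\<bar> \<le> M * \<bar>u - v\<bar>"
proof -
  obtain M where M: "M > 0" "\<And>u. 1/2 \<le> u \<Longrightarrow> u \<le> 3 \<Longrightarrow> u powr (L - 1) \<le> M"
    by (rule powr_bounded_on_interval[of "L - 1"]) blast
  show thesis
  proof (rule that)
    show "\<bar>L\<bar> * M + 1 > 0" using M(1) by (simp add: add_nonneg_pos)
    fix u v :: real assume uv: "u \<in> {1/2..3}" "v \<in> {1/2..3}"
    have "norm (u powr L - v powr L) \<le> (\<bar>L\<bar> * M + 1) * norm (u - v)"
    proof (rule field_differentiable_bound[OF convex_real_interval(5)[of "1/2" 3]])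
      fix z :: real assume z: "z \<in> {1/2..3}"
      show "((\<lambda>x. x powr L) has_field_derivative L * z powr (L - 1)) (at z within {1/2..3})"
        using z by (intro has_field_derivative_at_within[OF has_real_derivative_powr]) auto
      have "\<bar>L\<bar> * z powr (L - 1) \<le> \<bar>L\<bar> * M" using M(2) z by (intro mult_left_mono) auto
      then show "norm (L * z powr (L - 1)) \<le> \<bar>L\<bar> * M + 1" by (simp add: abs_mult)
    qed (use uv in auto)
    then show "\<bar>u powr L - v powr L\<bar> \<le> (\<bar>L\<bar> * M + 1) * \<bar>u - v\<bar>" by simp
  qed
qed

text \<open>The remainder vanishes at 0 and has derivative
  \<open>K * (1 - (1 - z) powr (K - 1))\<close>, which is of order \<open>z\<close> by the Lipschitz
  bound for the exponent \<open>K - 1\<close>. The mean value inequality then gives a quadratic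
  error.\<close>

lemma powr_one_minus_expansion:
  fixes K :: real
  obtains C where "C > 0" "\<And>x. \<bar>x\<bar> \<le> 1/2 \<Longrightarrow> \<bar>(1 - x) powr K - (1 - K * x)\<bar> \<le> C * x\<^sup>2"
proof -
  obtain M where M: "M > 0" "\<And>u v. u \<in> {1/2..3} \<Longrightarrow> v \<in> {1/2..3} \<Longrightarrow> \<bar>u powr (K - 1) - v powr (K - 1)\<bar> \<le> M * \<bar>u - v\<bar>"
    by (rule powr_lipschitz[of "K - 1"]) blast
  show thesis
  proof (rule that)
    show "\<bar>K\<bar> * M + 1 > 0" using M(1) by (simp add: add_nonneg_pos)
    fix x :: real assume x: "\<bar>x\<bar> \<le> 1/2"
    define f where "f z = (1 - z) powr K - (1 - K * z)" for z
    have "norm (f x - f 0) \<le> (\<bar>K\<bar> * (M * \<bar>x\<bar>)) * norm (x - 0)"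
    proof (rule field_differentiable_bound[OF convex_real_interval(5)[of "- \<bar>x\<bar>" "\<bar>x\<bar>"]])
      fix z assume "z \<in> {- \<bar>x\<bar>..\<bar>x\<bar>}"
      then have z: "\<bar>z\<bar> \<le> \<bar>x\<bar>" "\<bar>z\<bar> \<le> 1/2" using x by auto
      show "(f has_field_derivative K * (1 - (1 - z) powr (K - 1))) (at z within {- \<bar>x\<bar>..\<bar>x\<bar>})"
        unfolding f_def using z by (auto intro!: derivative_eq_intros simp: algebra_simps powr_diff)
      have "\<bar>1 powr (K - 1) - (1 - z) powr (K - 1)\<bar> \<le> M * \<bar>1 - (1 - z)\<bar>"
        using z(2) by (intro M) (auto simp: abs_le_iff)
      also have "\<dots> \<le> M * \<bar>x\<bar>" using z M(1) by simp
      finally show "norm (K * (1 - (1 - z) powr (K - 1))) \<le> \<bar>K\<bar> * (M * \<bar>x\<bar>)"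
        by (simp add: abs_mult mult_left_mono)
    qed auto
    then have "\<bar>(1 - x) powr K - (1 - K * x)\<bar> \<le> \<bar>K\<bar> * M * x\<^sup>2"
      by (simp add: f_def power2_eq_square abs_mult_self mult.assoc)
    then show "\<bar>(1 - x) powr K - (1 - K * x)\<bar> \<le> (\<bar>K\<bar> * M + 1) * x\<^sup>2"
      by (simp add: distrib_right add_increasing2)
  qed
qed

text \<open>Reduces a real moment to the integer moments of orders 1 and \<open>m\<close>. For
  \<open>r \<le> 1\<close> the Lipschitz bound applies; for \<open>r > 1\<close> one has
  \<open>b + r \<le> 3 * r\<close> and \<open>r powr K \<le> r ^ m\<close>.\<close>

lemma powr_add_le:
  fixes K :: real
  assumes K: "0 < K" and m: "K \<le> real m"
  obtains C where "C > 0"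
    "\<And>b r. 1/2 \<le> b \<Longrightarrow> b \<le> 2 \<Longrightarrow> 0 \<le> r \<Longrightarrow> (b + r) powr K \<le> b powr K + C * (r + r ^ m)"
proof -
  obtain M where M: "M > 0" "\<And>u v. u \<in> {1/2..3} \<Longrightarrow> v \<in> {1/2..3} \<Longrightarrow> \<bar>u powr K - v powr K\<bar> \<le> M * \<bar>u - v\<bar>"
    by (rule powr_lipschitz[of K]) blast
  show thesis
  proof (rule that)
    show "M + 3 powr K > 0" using M(1) by (simp add: add_pos_pos)
    fix b r :: real assume b: "1/2 \<le> b" "b \<le> 2" and r: "0 \<le> r"
    have nn: "0 \<le> M * r" "0 \<le> M * r ^ m" "0 \<le> 3 powr K * r" "0 \<le> 3 powr K * r ^ m" using M(1) r by auto
    show "(b + r) powr K \<le> b powr K + (M + 3 powr K) * (r + r ^ m)"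
    proof (cases "r \<le> 1")
      case True
      have "\<bar>(b + r) powr K - b powr K\<bar> \<le> M * \<bar>b + r - b\<bar>" using b r True by (intro M) auto
      then have "(b + r) powr K - b powr K \<le> M * r" using r by simp
      then show ?thesis using nn by (simp add: algebra_simps)
    next
      case False
      then have "(b + r) powr K \<le> (3 * r) powr K" using b K by (intro powr_mono2) auto
      also have "\<dots> = 3 powr K * r powr K" using r by (simp add: powr_mult)
      also have "r powr K \<le> r powr real m" using False m by (intro powr_mono) auto
      also have "r powr real m = r ^ m" using False by (simp add: powr_realpow)
      finally have "(b + r) powr K \<le> 3 powr K * r ^ m" by simp
      moreover have "0 \<le> b powr K" by simp
      moreover have "(M + 3 powr K) * (r + r ^ m) = M * r + M * r ^ m + 3 powr K * r + 3 powr K * r ^ m"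
        by (simp add: algebra_simps)
      ultimately show ?thesis using nn by linarith
    qed
  qed
qed

text \<open>The base is a deterministic number \<open>b\<close> near \<open>1 - a\<close> plus a
  nonnegative random term. Monotonicity gives the lower bound \<open>b powr K\<close>;
  \<open>powr_add_le\<close> and the defect moments give an upper bound larger by
  \<open>O(a^2)\<close> only.\<close>

lemma moment_estimate:
  fixes K :: real
  assumes K: "0 < K"
  obtains C where "C > 0"
    "\<And>N a \<mu>. N \<ge> 1 \<Longrightarrow> 0 < a \<Longrightarrow> a \<le> 1/8 \<Longrightarrow> haar_prob_SO (2 * N + 1) \<mu> \<Longrightarrow>
      \<bar>(\<integral>X. (- (a / real N) * log_deriv (char_fun X) (exp (- (a / real N)))) powr K \<partial>\<mu>) - (1 - K * a)\<bar>
        \<le> C * (a / real N + a\<^sup>2)"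
proof -
  define m where "m = nat \<lceil>K\<rceil>"
  have m: "K \<le> real m" "m \<ge> 1" using K by (auto simp: m_def le_nat_iff)
  obtain C1 where C1: "C1 > 0" "\<And>N s \<mu>. 1/2 \<le> s \<Longrightarrow> s < 1 \<Longrightarrow> ((1 - s) * real N)\<^sup>2 \<le> 1 \<Longrightarrow> haar_prob_SO (2 * N + 1) \<mu> \<Longrightarrow>
    (\<integral>X. ((1 - s) * defect (2 * N + 1) N s X) ^ 1 \<partial>\<mu>) \<le> C1 * ((1 - s) * real N)\<^sup>2"
    using scaled_defect_moments[of 1] by auto
  obtain Cm where Cm: "Cm > 0" "\<And>N s \<mu>. 1/2 \<le> s \<Longrightarrow> s < 1 \<Longrightarrow> ((1 - s) * real N)\<^sup>2 \<le> 1 \<Longrightarrow> haar_prob_SO (2 * N + 1) \<mu> \<Longrightarrow>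
    (\<integral>X. ((1 - s) * defect (2 * N + 1) N s X) ^ m \<partial>\<mu>) \<le> Cm * ((1 - s) * real N)\<^sup>2"
    using scaled_defect_moments[OF m(2)] by auto
  obtain A where A: "A > 0" "\<And>b r. 1/2 \<le> b \<Longrightarrow> b \<le> 2 \<Longrightarrow> 0 \<le> r \<Longrightarrow> (b + r) powr K \<le> b powr K + A * (r + r ^ m)"
    by (rule powr_add_le[OF K m(1)]) blast
  obtain T where T: "T > 0" "\<And>x. \<bar>x\<bar> \<le> 1/2 \<Longrightarrow> \<bar>(1 - x) powr K - (1 - K * x)\<bar> \<le> T * x\<^sup>2"
    by (rule powr_one_minus_expansion[of K]) blast
  define C where "C = A * (4 * C1 + 4 ^ m * Cm) + 16 * T + 3 * K"
  show thesis
  proof (rule that)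
    show "C > 0" unfolding C_def using A C1 Cm T K by (intro add_pos_pos mult_pos_pos zero_less_power) auto
    fix N :: nat and a :: real and \<mu> :: "real mat measure"
    assume N: "N \<ge> 1" and a: "0 < a" "a \<le> 1/8" and haar: "haar_prob_SO (2 * N + 1) \<mu>"
    define \<alpha> where "\<alpha> = a / real N"
    define s where "s = exp (- \<alpha>)"
    have \<alpha>a: "\<alpha> * real N = a" using N by (simp add: \<alpha>_def)
    have \<alpha>: "0 < \<alpha>" "\<alpha> \<le> a" using N a by (auto simp: \<alpha>_def field_simps)
    then have \<alpha>2: "\<alpha> \<le> 1/2" using a by simp
    note e = exp_neg_estimates[OF \<alpha>(1) \<alpha>2, folded s_def]
    have s: "0 < s" "s < 1" using e by auto
    interpret prob_space \<mu> using haar by (simp add: haar_prob_SO_def)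
    have sp: "space \<mu> = SO (2 * N + 1)" using haar by (simp add: haar_prob_SO_def)
    have "(1 - s) * real N \<le> a" using mult_right_mono[OF e(3), of "real N"] \<alpha>a by simp
    then have sN: "((1 - s) * real N)\<^sup>2 \<le> a\<^sup>2" using s by (intro power_mono) auto
    also have "a\<^sup>2 \<le> 1" using a by (simp add: power_le_one)
    finally have d1: "((1 - s) * real N)\<^sup>2 \<le> 1" .

    \<comment> \<open>\<open>b\<close> is the deterministic part of the base and \<open>x\<close>
      its distance below 1, while \<open>k\<close> turns the term \<open>\<alpha> / s\<close> times
      the defect into \<open>k * \<rho> X\<close>.\<close>
    define b where "b = \<alpha> / (1 - s) - a / s"
    define x where "x = 1 - b"
    define \<rho> where "\<rho> X = (1 - s) * defect (2 * N + 1) N s X" for X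
    define k where "k = \<alpha> / s / (1 - s)"
    have as: "a \<le> a / s" "a / s \<le> a + \<alpha>"
    proof -
      show "a \<le> a / s" using mult_left_mono[OF e(6), of a] a by simp
      have "a / s \<le> a * (1 + 2 * \<alpha>)" using mult_left_mono[OF e(7), of a] a by simp
      also have "\<dots> = a + (2 * a) * \<alpha>" by (simp add: algebra_simps)
      also have "(2 * a) * \<alpha> \<le> 1 * \<alpha>" using a \<alpha> by (intro mult_right_mono) auto
      finally show "a / s \<le> a + \<alpha>" by simp
    qed
    \<comment> \<open>\<open>\<alpha> / (1 - s)\<close> lies in \<open>[1, 1 + \<alpha>]\<close> and
      \<open>a / s\<close> in \<open>[a, a + \<alpha>]\<close>, so the errors in \<open>x\<close>
      partly offset each other.\<close>
    have xa: "\<bar>x - a\<bar> \<le> \<alpha>" unfolding x_def b_def using as e(4,5) by linarith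
    have x: "\<bar>x\<bar> \<le> 2 * a" using xa \<alpha> a by linarith
    have b: "1/2 \<le> b" "b \<le> 2" using x a unfolding x_def by linarith+
    have k: "0 \<le> k" "k \<le> 4"
    proof -
      have "\<alpha> / (1 - s) * (1 / s) \<le> (1 + \<alpha>) * (1 + 2 * \<alpha>)"
        using e \<alpha> s by (intro mult_mono) auto
      also have "\<dots> \<le> 2 * 2" using \<alpha>2 \<alpha> by (intro mult_mono) auto
      finally show "k \<le> 4" by (simp add: k_def mult.commute)
      show "0 \<le> k" using s \<alpha> by (simp add: k_def)
    qed
    have base: "- \<alpha> * log_deriv (char_fun X) s = b + k * \<rho> X" if "X \<in> SO (2 * N + 1)" for X
      using log_deriv_char_fun_defect[OF that s, of \<alpha>] s unfolding \<alpha>a by (simp add: b_def k_def \<rho>_def)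
    have \<rho>0: "0 \<le> \<rho> X" if "X \<in> SO (2 * N + 1)" for X
      unfolding \<rho>_def using defect_bounds(1)[OF refl s that] s by simp
    have \<rho>m: "\<rho> \<in> borel_measurable \<mu>"
      unfolding \<rho>_def[abs_def] using resolvent_measurable_haar(2)[OF refl s haar] by measurable
    have \<rho>i: "integrable \<mu> (\<lambda>X. \<rho> X ^ p)" for p
      unfolding \<rho>_def power_mult_distrib using integrable_defect_power[OF refl s haar] by (intro integrable_mult_right)
    \<comment> \<open>An integrable majorant of the integrand; the powers of 4 come from
      \<open>k \<le> 4\<close>.\<close>
    define U where "U X = b powr K + A * (4 * \<rho> X ^ 1 + 4 ^ m * \<rho> X ^ m)" for X
    have Ui: "integrable \<mu> U" unfolding U_def[abs_def]
      by (intro Bochner_Integration.integrable_add integrable_mult_right \<rho>i integrable_const)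
    define g where "g X = (b + k * \<rho> X) powr K" for X
    have gm: "g \<in> borel_measurable \<mu>" unfolding g_def[abs_def] using \<rho>m by measurable
    have gU: "g X \<le> U X" and gb: "b powr K \<le> g X" if "X \<in> space \<mu>" for X
    proof -
      have r: "0 \<le> \<rho> X" using \<rho>0 that sp by simp
      have kr: "0 \<le> k * \<rho> X" "k * \<rho> X \<le> 4 * \<rho> X" using k r by (auto intro: mult_right_mono)
      have "g X \<le> b powr K + A * (k * \<rho> X + (k * \<rho> X) ^ m)"
        unfolding g_def by (rule A(2)[OF b kr(1)])
      also have "A * (k * \<rho> X + (k * \<rho> X) ^ m) \<le> A * (4 * \<rho> X + (4 * \<rho> X) ^ m)"
        using A kr by (intro mult_left_mono add_mono power_mono) auto
      finally show "g X \<le> U X" by (simp add: U_def power_mult_distrib)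
      show "b powr K \<le> g X" unfolding g_def using b K kr by (intro powr_mono2) auto
    qed
    have gi: "integrable \<mu> g"
    proof (rule Bochner_Integration.integrable_bound[OF Ui gm], rule AE_I2)
      fix X assume X: "X \<in> space \<mu>"
      have "0 \<le> g X" by (simp add: g_def)
      then show "norm (g X) \<le> norm (U X)" using gU[OF X] by simp
    qed
    have int_eq: "(\<integral>X. (- \<alpha> * log_deriv (char_fun X) s) powr K \<partial>\<mu>) = (\<integral>X. g X \<partial>\<mu>)"
      using base sp by (intro Bochner_Integration.integral_cong) (auto simp: g_def)
    have lower: "b powr K \<le> (\<integral>X. g X \<partial>\<mu>)"
    proof -
      have "(\<integral>X. b powr K \<partial>\<mu>) \<le> (\<integral>X. g X \<partial>\<mu>)"
        by (rule integral_mono) (use gi gb in auto)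
      then show ?thesis by (simp add: prob_space)
    qed
    have upper: "(\<integral>X. g X \<partial>\<mu>) \<le> b powr K + A * (4 * C1 + 4 ^ m * Cm) * a\<^sup>2"
    proof -
      have "(\<integral>X. g X \<partial>\<mu>) \<le> (\<integral>X. U X \<partial>\<mu>)"
        by (rule integral_mono[OF gi Ui gU])
      also have "\<dots> = b powr K + A * (4 * (\<integral>X. \<rho> X ^ 1 \<partial>\<mu>) + 4 ^ m * (\<integral>X. \<rho> X ^ m \<partial>\<mu>))"
        unfolding U_def[abs_def] using \<rho>i[of 1] \<rho>i[of m] by (simp add: prob_space)
      also have "\<dots> \<le> b powr K + A * (4 * (C1 * a\<^sup>2) + 4 ^ m * (Cm * a\<^sup>2))"
      proof (intro add_left_mono mult_left_mono add_mono)
        show "(\<integral>X. \<rho> X ^ 1 \<partial>\<mu>) \<le> C1 * a\<^sup>2"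
          using C1(2)[OF e(1,2) d1 haar] mult_left_mono[OF sN, of C1] C1(1) unfolding \<rho>_def by linarith
        show "(\<integral>X. \<rho> X ^ m \<partial>\<mu>) \<le> Cm * a\<^sup>2"
          using Cm(2)[OF e(1,2) d1 haar] mult_left_mono[OF sN, of Cm] Cm(1) unfolding \<rho>_def by linarith
      qed (use A in auto)
      also have "\<dots> = b powr K + A * (4 * C1 + 4 ^ m * Cm) * a\<^sup>2" by (simp add: algebra_simps)
      finally show ?thesis .
    qed
    have "\<bar>b powr K - (1 - K * x)\<bar> \<le> T * x\<^sup>2"
      using T(2)[of x] x a by (simp add: x_def)
    also have "x\<^sup>2 \<le> (2 * a)\<^sup>2" using power_mono[OF x abs_ge_zero, of 2] by simp
    then have "T * x\<^sup>2 \<le> T * (4 * a\<^sup>2)" using T(1) by (intro mult_left_mono) (auto simp: power_mult_distrib)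
    finally have taylor: "\<bar>b powr K - (1 - K * x)\<bar> \<le> 4 * T * a\<^sup>2" by simp
    have Kx: "\<bar>K * x - K * a\<bar> \<le> K * \<alpha>"
      using mult_left_mono[OF xa, of K] K by (simp add: abs_mult right_diff_distrib[symmetric])
    have "\<bar>(\<integral>X. g X \<partial>\<mu>) - (1 - K * a)\<bar> \<le> A * (4 * C1 + 4 ^ m * Cm) * a\<^sup>2 + 4 * T * a\<^sup>2 + K * \<alpha>"
      using lower upper taylor Kx by linarith
    also have "\<dots> \<le> C * (\<alpha> + a\<^sup>2)"
    proof -
      define P where "P = A * (4 * C1 + 4 ^ m * Cm)"
      have "0 \<le> P * \<alpha>" "0 \<le> T * \<alpha>" "0 \<le> K * a\<^sup>2" "0 \<le> T * a\<^sup>2" "0 \<le> K * \<alpha>"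
        using A C1 Cm T K \<alpha> a by (auto simp: P_def)
      moreover have "C * (\<alpha> + a\<^sup>2) = P * \<alpha> + P * a\<^sup>2 + 16 * (T * \<alpha>) + 16 * (T * a\<^sup>2) + 3 * (K * \<alpha>) + 3 * (K * a\<^sup>2)"
        unfolding C_def P_def[symmetric] by (simp add: algebra_simps)
      ultimately show ?thesis unfolding P_def[symmetric] by linarith
    qed
    finally show "\<bar>(\<integral>X. (- (a / real N) * log_deriv (char_fun X) (exp (- (a / real N)))) powr K \<partial>\<mu>) - (1 - K * a)\<bar>
        \<le> C * (a / real N + a\<^sup>2)"
      unfolding int_eq[unfolded s_def \<alpha>_def] unfolding \<alpha>_def .
  qed
qed

theorem theorem2:
  fixes K :: real and \<mu> :: "nat \<Rightarrow> real mat measure"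
  assumes K: "K > 0"
    and haar: "\<And>N. haar_prob_SO (2 * N + 1) (\<mu> N)"
  shows "\<exists>C::real. \<forall>a :: nat \<Rightarrow> real. (\<forall>N. a N > 0) \<longrightarrow> a \<longlonglongrightarrow> 0 \<longrightarrow>
    (\<exists>E1 E2 :: nat \<Rightarrow> real.
       (\<forall>\<^sub>F N in sequentially. \<bar>E1 N\<bar> \<le> C * (a N / real N)) \<and>
       (\<forall>\<^sub>F N in sequentially. \<bar>E2 N\<bar> \<le> C * (a N)\<^sup>2) \<and>
       (\<forall>\<^sub>F N in sequentially.
          (let \<alpha> = a N / real N in
            (\<integral>X. (- a N / real N * log_deriv (char_fun X) (exp (- \<alpha>))) powr K \<partial>\<mu> N))
          = 1 - K * a N + E1 N + E2 N))"
proof -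
  obtain C where C: "C > 0"
    "\<And>N a \<mu>. N \<ge> 1 \<Longrightarrow> 0 < a \<Longrightarrow> a \<le> 1/8 \<Longrightarrow> haar_prob_SO (2 * N + 1) \<mu> \<Longrightarrow>
      \<bar>(\<integral>X. (- (a / real N) * log_deriv (char_fun X) (exp (- (a / real N)))) powr K \<partial>\<mu>) - (1 - K * a)\<bar>
        \<le> C * (a / real N + a\<^sup>2)"
    by (rule moment_estimate[OF K]) blast
  show ?thesis
  \<comment> \<open>The constant depends on \<open>K\<close> alone and is fixed before the sequence
    \<open>a\<close>.\<close>
  proof (intro exI[of _ C] allI impI)
    fix a :: "nat \<Rightarrow> real" assume pos: "\<forall>N. a N > 0" and lim: "a \<longlonglongrightarrow> 0"
    define I where "I N = (\<integral>X. (- (a N / real N) * log_deriv (char_fun X) (exp (- (a N / real N)))) powr K \<partial>\<mu> N)" for N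
    define d where "d N = I N - (1 - K * a N)" for N
    define p where "p N = a N / real N" for N
    define q where "q N = p N + (a N)\<^sup>2" for N
    \<comment> \<open>The total error \<open>d\<close> is shared in proportion to the two scales
      \<open>a / N\<close> and \<open>a^2\<close>, so that each share is at most \<open>C\<close>
      times its own scale.\<close>
    define E1 where "E1 N = d N * (p N / q N)" for N
    define E2 where "E2 N = d N * ((a N)\<^sup>2 / q N)" for N
    have p0: "0 \<le> p N" for N using pos by (simp add: p_def less_imp_le)
    have q0: "0 < q N" for N unfolding q_def using pos p0 by (intro add_nonneg_pos zero_less_power) auto
    have "\<forall>\<^sub>F N in sequentially. a N < 1/8" by (rule order_tendstoD[OF lim]) simp
    then have ev: "\<forall>\<^sub>F N in sequentially. \<bar>d N\<bar> \<le> C * q N"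
      using eventually_ge_at_top[of 1]
    proof eventually_elim
      case (elim N)
      then show ?case
        using C(2)[OF elim(2) _ _ haar, of "a N"] pos by (simp add: d_def I_def q_def p_def)
    qed
    have share: "\<bar>x * (y / z)\<bar> \<le> C * y" if "\<bar>x\<bar> \<le> C * z" "0 < z" "0 \<le> y" for x y z :: real
    proof -
      have "\<bar>x * (y / z)\<bar> = \<bar>x\<bar> * (y / z)" using that by (simp add: abs_mult)
      also have "\<dots> \<le> C * z * (y / z)" using that by (intro mult_right_mono) auto
      finally show ?thesis using that by simp
    qed
    have "\<forall>\<^sub>F N in sequentially. \<bar>E1 N\<bar> \<le> C * (a N / real N)"
      using ev by eventually_elim (unfold E1_def p_def[symmetric], rule share[OF _ q0 p0])
    moreover have "\<forall>\<^sub>F N in sequentially. \<bar>E2 N\<bar> \<le> C * (a N)\<^sup>2"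
      using ev by eventually_elim (unfold E2_def, rule share[OF _ q0], auto)
    moreover have "I N = 1 - K * a N + E1 N + E2 N" for N
    proof -
      have "E1 N + E2 N = d N * ((p N + (a N)\<^sup>2) / q N)"
        by (simp add: E1_def E2_def distrib_left add_divide_distrib)
      also have "\<dots> = d N" using q0[of N] by (simp add: q_def)
      finally show ?thesis by (simp add: d_def)
    qed
    ultimately show "\<exists>E1 E2 :: nat \<Rightarrow> real.
       (\<forall>\<^sub>F N in sequentially. \<bar>E1 N\<bar> \<le> C * (a N / real N)) \<and>
       (\<forall>\<^sub>F N in sequentially. \<bar>E2 N\<bar> \<le> C * (a N)\<^sup>2) \<and>
       (\<forall>\<^sub>F N in sequentially.
          (let \<alpha> = a N / real N in
            (\<integral>X. (- a N / real N * log_deriv (char_fun X) (exp (- \<alpha>))) powr K \<partial>\<mu> N))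
          = 1 - K * a N + E1 N + E2 N)"
      by (intro exI[of _ E1] exI[of _ E2]) (simp add: I_def Let_def)
  qed
qed

end
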